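(* Let $0<\rho<1$. For every $c>0$ and $0<\eta<1/2$ there exist $n_0(c,\eta)$ and $K_{c,\eta}>0$ (depending only on $c$ and $\eta$) such that, for all odd $n=2N+1\ge n_0(c,\eta)$ and all integers $m$ with $1\le m\le c\,n^{1/2-\eta}$, $$\inf_{\deg p\le m}\ \|T_\rho\mathrm{Maj}_n-p\|_{L^1(U_n)}\ \ge\ K_{c,\eta}\,\frac{\rho^{2m+1}}{\sqrt m},$$ where the infimum is over real multilinear polynomials $p$ on $\{\pm1\}^n$ of degree at most $m$.
   Context: $U_n$ is the uniform probability measure on $\{\pm1\}^n$, and $\|f\|_{L^1(U_n)}=\mathbb E_{X\sim U_n}|f(X)|$. For odd $n$, $\mathrm{Maj}_n(x)=\mathrm{sign}(\sum_{i=1}^n x_i)\in\{\pm1\}$. The noise operator $T_\rho$ acts on $f:\{\pm1\}^n\to\mathbb R$ by $T_\rho f(x)=\mathbb E[f(Y)]$, where the coordinates $Y_i\in\{\pm1\}$ are independent with $\mathbb E[Y_i]=\rho x_i$; equivalently $T_\rho f=\sum_{S\subseteq[n]}\rho^{|S|}\hat f(S)\chi_S$ with $\chi_S(x)=\prod_{i\in S}x_i$ and $\hat f(S)=\mathbb E_{X\sim U_n}[f(X)\chi_S(X)]$. *)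

theory Defs
  imports "HOL-Probability.Probability"
begin

text \<open>Points of the cube are extensional functions on \<open>{1..n}\<close>, i.e. \<open>undefined\<close> outside it, so
  that the cube is a finite set with \<open>2 ^ n\<close> elements.\<close>

definition cube :: "nat \<Rightarrow> (nat \<Rightarrow> real) set" where
  "cube n = {1..n} \<rightarrow>\<^sub>E {-1, 1}"

definition unif_cube :: "nat \<Rightarrow> (nat \<Rightarrow> real) pmf" where
  "unif_cube n = pmf_of_set (cube n)"

definition L1_norm :: "nat \<Rightarrow> ((nat \<Rightarrow> real) \<Rightarrow> real) \<Rightarrow> real" where
  "L1_norm n f = measure_pmf.expectation (unif_cube n) (\<lambda>x. \<bar>f x\<bar>)"

text \<open>For odd \<open>n\<close> the sum is nonzero on the cube, so that the value is \<open>1\<close> or \<open>-1\<close>.\<close>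

definition Maj :: "nat \<Rightarrow> (nat \<Rightarrow> real) \<Rightarrow> real" where
  "Maj n x = sgn (\<Sum>i=1..n. x i)"

definition sign_pmf :: "real \<Rightarrow> real pmf" where
  "sign_pmf \<mu> = map_pmf (\<lambda>b. if b then 1 else -1) (bernoulli_pmf ((1 + \<mu>) / 2))"

lemma set_sign_pmf: "set_pmf (sign_pmf \<mu>) \<subseteq> {-1, 1}"
  by (auto simp: sign_pmf_def)

lemma expectation_sign_pmf:
  assumes "-1 \<le> \<mu>" "\<mu> \<le> 1"
  shows "measure_pmf.expectation (sign_pmf \<mu>) (\<lambda>y. y) = \<mu>"
  using assms by (simp add: sign_pmf_def field_simps)

text \<open>The law of \<open>Y\<close> given \<open>x\<close>: independent signs \<open>Y i\<close> of mean \<open>\<rho> * x i\<close>, for \<open>i \<in> {1..n}\<close>.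
  The default value \<open>undefined\<close> keeps the samples inside the cube.\<close>

definition noise_pmf :: "nat \<Rightarrow> real \<Rightarrow> (nat \<Rightarrow> real) \<Rightarrow> (nat \<Rightarrow> real) pmf" where
  "noise_pmf n \<rho> x = Pi_pmf {1..n} undefined (\<lambda>i. sign_pmf (\<rho> * x i))"

definition noise_op ::
  "nat \<Rightarrow> real \<Rightarrow> ((nat \<Rightarrow> real) \<Rightarrow> real) \<Rightarrow> (nat \<Rightarrow> real) \<Rightarrow> real" where
  "noise_op n \<rho> f x = measure_pmf.expectation (noise_pmf n \<rho> x) f"

definition multilinear_polys :: "nat \<Rightarrow> nat \<Rightarrow> ((nat \<Rightarrow> real) \<Rightarrow> real) set" where
  "multilinear_polys n m =
    {p. \<exists>a :: nat set \<Rightarrow> real.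
      p = (\<lambda>x. \<Sum>S | S \<subseteq> {1..n} \<and> card S \<le> m. a S * (\<Prod>i\<in>S. x i))}"

end

(* Duality. Put k = 2 M + 1 with M = ceiling (m / 2), and n = 2 (M + L + r) + 1. Let g be the
   symmetric function on the cube whose value at a point with j coordinates -1 is a normalisation
   of [y^j] y^r (1 - y)^k (1 + y)^(2 L) / (n choose j), a discrete analogue of the Gaussian test
   function He_k (sqrt 2 x) exp (- x^2 / 2). Its Walsh coefficients at the levels k + 2 i,
   0 <= i <= r, are (-1)^i (r choose i) / (n choose (k + 2 i)), all others vanish. So g is
   orthogonal to degree <= m, and at every level the sign of the coefficient agrees, up to the
   common factor (-1)^M, with that of Maj. Writing <.> for the mean over t in [0, 2 pi] and
   sigma = sin^2 (t / 2), the pairing of g with T_rho Maj is therefore, up to sign,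
     rho^k <sigma^M (1 - sigma)^L (1 - (1 - rho^2) sigma)^r>,
   which by Jensen is at least rho^k W (1 - (1 - rho^2) s)^r, where W = <sigma^M (1 - sigma)^L>
   and s = (M + 1/2) / (M + L + 1).

   For the uniform bound on g, Cauchy's estimate is applied on the circle of radius j / (n - j),
   where the exponential factors cancel against the entropy lower bound for (n choose j). It
   remains to bound (1 - p)^r <(p + (1 - p) sigma)^a (p + (1 - p) (1 - sigma))^b> by a multiple
   of <sigma^a (1 - sigma)^b>. Expanding binomially, each term is a trinomial term up to the
   ratios of x! / (1/2)_x, which grow at most like 4 (1 + 1 / sqrt a)^d, and r slightly larger
   than a + b compensates for this growth. Finally, with r s <= M + O(sqrt M), the factor
   (1 - (1 - rho^2) s)^r costs at most a constant times rho^(2 m - 2 M). *)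

theory Submission
  imports Defs
begin

section \<open>Walsh functions and the noise operator\<close>


definition walsh :: "nat set \<Rightarrow> (nat \<Rightarrow> real) \<Rightarrow> real" where
  "walsh S x = (\<Prod>i\<in>S. x i)"

lemma finite_cube [simp]: "finite (cube n)"
  unfolding cube_def by (intro finite_PiE) auto

lemma cube_nonempty [simp]: "cube n \<noteq> {}"
  unfolding cube_def by (subst PiE_eq_empty_iff) auto

lemma card_cube: "card (cube n) = 2 ^ n"
  unfolding cube_def by (subst card_PiE) (auto simp: card_insert_if numeral_2_eq_2)

lemma cube_cases: "x \<in> cube n \<Longrightarrow> i \<in> {1..n} \<Longrightarrow> x i = -1 \<or> x i = 1"
  unfolding cube_def by (drule PiE_mem) auto

text \<open>The orthogonality of the Walsh functions, their behaviour under noise and the count over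
  levels all come from this factorisation over coordinates. The values lie in a commutative semiring
  because the level count uses polynomial-valued factors.\<close>

lemma sum_cube_prod:
  fixes f :: "nat \<Rightarrow> real \<Rightarrow> 'a::comm_semiring_1"
  shows "(\<Sum>x\<in>cube n. \<Prod>i\<in>{1..n}. f i (x i)) = (\<Prod>i\<in>{1..n}. f i (-1) + f i 1)"
  unfolding cube_def by (subst prod_sum_PiE [symmetric]) auto

lemma walsh_eq_prod_if:
  "S \<subseteq> {1..n} \<Longrightarrow> walsh S x = (\<Prod>i\<in>{1..n}. if i \<in> S then x i else 1)"
  unfolding walsh_def by (subst prod.inter_restrict [symmetric]) (auto simp: Int_absorb1)

lemma L1_norm_eq_sum: "L1_norm n f = (\<Sum>x\<in>cube n. \<bar>f x\<bar>) / 2 ^ n"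
  unfolding L1_norm_def unif_cube_def
  by (subst integral_pmf_of_set) (auto simp: card_cube)

lemma pmf_sign_pmf:
  assumes "-1 \<le> \<mu>" "\<mu> \<le> 1" "y = -1 \<or> y = 1"
  shows "pmf (sign_pmf \<mu>) y = (1 + \<mu> * y) / 2"
proof -
  have inj: "inj (\<lambda>b. if b then 1 else (-1::real))"
    by (auto simp: inj_def split: if_splits)
  have "pmf (sign_pmf \<mu>) ((\<lambda>b. if b then 1 else (-1::real)) b) = pmf (bernoulli_pmf ((1 + \<mu>) / 2)) b" for b
    unfolding sign_pmf_def by (rule pmf_map_inj'[OF inj])
  from this[of True] this[of False] show ?thesis
    using assms by (auto simp: field_simps)
qed

lemma noise_op_eq_sum:
  assumes "0 < \<rho>" "\<rho> < 1" "x \<in> cube n"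
  shows "noise_op n \<rho> f x = (\<Sum>y\<in>cube n. f y * (\<Prod>i\<in>{1..n}. (1 + \<rho> * x i * y i) / 2))"
proof -
  have "set_pmf (noise_pmf n \<rho> x) \<subseteq> cube n"
  proof
    fix y assume "y \<in> set_pmf (noise_pmf n \<rho> x)"
    then have "y \<in> PiE_dflt {1..n} undefined (set_pmf \<circ> (\<lambda>i. sign_pmf (\<rho> * x i)))"
      unfolding noise_pmf_def by (subst (asm) set_Pi_pmf) auto
    then show "y \<in> cube n"
      using set_sign_pmf by (fastforce simp: PiE_dflt_def cube_def PiE_def extensional_def)
  qed
  then have "noise_op n \<rho> f x = (\<Sum>y\<in>cube n. f y * pmf (noise_pmf n \<rho> x) y)"
    unfolding noise_op_def by (subst integral_measure_pmf_real[of "cube n"]) auto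
  also have "\<dots> = (\<Sum>y\<in>cube n. f y * (\<Prod>i\<in>{1..n}. (1 + \<rho> * x i * y i) / 2))"
  proof (intro sum.cong refl arg_cong2[of _ _ _ _ "(*)"])
    fix y assume y: "y \<in> cube n"
    have "pmf (noise_pmf n \<rho> x) y = (\<Prod>i\<in>{1..n}. pmf (sign_pmf (\<rho> * x i)) (y i))"
      unfolding noise_pmf_def using y
      by (subst pmf_Pi') (auto simp: cube_def PiE_def extensional_def)
    also have "\<dots> = (\<Prod>i\<in>{1..n}. (1 + \<rho> * x i * y i) / 2)"
    proof (intro prod.cong refl)
      fix i assume "i \<in> {1..n}"
      with cube_cases[OF assms(3), of i] cube_cases[OF y, of i] assms(1,2)
      show "pmf (sign_pmf (\<rho> * x i)) (y i) = (1 + \<rho> * x i * y i) / 2"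
        by (subst pmf_sign_pmf) auto
    qed
    finally show "pmf (noise_pmf n \<rho> x) y = (\<Prod>i\<in>{1..n}. (1 + \<rho> * x i * y i) / 2)" .
  qed
  finally show ?thesis .
qed

text \<open>After inserting the noise kernel and swapping the sums, the sum over \<open>x\<close>
  factorises: a coordinate in \<open>S\<close> contributes \<open>\<rho> * y i\<close>, any other
  contributes 1. No Fourier expansion of \<open>f\<close> is required.\<close>

lemma sum_walsh_noise_op:
  assumes "0 < \<rho>" "\<rho> < 1" "S \<subseteq> {1..n}"
  shows "(\<Sum>x\<in>cube n. walsh S x * noise_op n \<rho> f x) = \<rho> ^ card S * (\<Sum>y\<in>cube n. walsh S y * f y)"
proof -
  have "(\<Sum>x\<in>cube n. walsh S x * noise_op n \<rho> f x)
      = (\<Sum>x\<in>cube n. \<Sum>y\<in>cube n. f y * (\<Prod>i\<in>{1..n}. (if i \<in> S then x i else 1) * ((1 + \<rho> * x i * y i) / 2)))"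
    using assms
    by (intro sum.cong refl)
       (simp only: noise_op_eq_sum walsh_eq_prod_if sum_distrib_left prod.distrib mult.left_commute)
  also have "\<dots> = (\<Sum>y\<in>cube n. f y * (\<Sum>x\<in>cube n. \<Prod>i\<in>{1..n}. (if i \<in> S then x i else 1) * ((1 + \<rho> * x i * y i) / 2)))"
    by (subst sum.swap) (simp add: sum_distrib_left)
  also have "\<dots> = (\<Sum>y\<in>cube n. f y * (\<rho> ^ card S * walsh S y))"
  proof (intro sum.cong refl arg_cong2[of _ _ _ _ "(*)"])
    fix y
    have "(\<Sum>x\<in>cube n. \<Prod>i\<in>{1..n}. (if i \<in> S then x i else 1) * ((1 + \<rho> * x i * y i) / 2))
        = (\<Prod>i\<in>{1..n}. if i \<in> S then \<rho> * y i else 1)"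
      by (subst sum_cube_prod[where f="\<lambda>i t. (if i \<in> S then t else 1) * ((1 + \<rho> * t * y i) / 2)"])
         (intro prod.cong refl, auto simp: field_simps)
    also have "\<dots> = (\<Prod>i\<in>S. \<rho> * y i)"
      using assms(3) by (subst prod.inter_restrict [symmetric]) (auto simp: Int_absorb1)
    also have "\<dots> = \<rho> ^ card S * walsh S y"
      by (simp add: prod.distrib walsh_def)
    finally show "(\<Sum>x\<in>cube n. \<Prod>i\<in>{1..n}. (if i \<in> S then x i else 1) * ((1 + \<rho> * x i * y i) / 2))
      = \<rho> ^ card S * walsh S y" .
  qed
  finally show ?thesis
    by (simp add: sum_distrib_left mult_ac)
qed

lemma sum_walsh_walsh:
  assumes "S \<subseteq> {1..n}" "T \<subseteq> {1..n}"
  shows "(\<Sum>x\<in>cube n. walsh S x * walsh T x) = (if S = T then 2 ^ n else 0)"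
proof -
  have "(\<Sum>x\<in>cube n. walsh S x * walsh T x)
      = (\<Sum>x\<in>cube n. \<Prod>i\<in>{1..n}. (if i \<in> S then x i else 1) * (if i \<in> T then x i else 1))"
    using assms by (simp add: walsh_eq_prod_if prod.distrib)
  also have "\<dots> = (\<Prod>i\<in>{1..n}. if i \<in> S \<longleftrightarrow> i \<in> T then 2 else 0)"
    by (subst sum_cube_prod[where f="\<lambda>i t. (if i \<in> S then t else 1) * (if i \<in> T then t else 1)"])
       (intro prod.cong refl, auto)
  also have "\<dots> = (if S = T then 2 ^ n else 0)"
  proof (cases "S = T")
    case False
    then obtain i where "i \<in> {1..n}" "\<not> (i \<in> S \<longleftrightarrow> i \<in> T)" using assms by blast
    with False show ?thesis by (auto intro!: prod_zero)
  qed auto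
  finally show ?thesis .
qed

section \<open>Krawtchouk coefficients\<close>


text \<open>In the usual notation this is K_j(q): \<open>j\<close> is the degree and
  \<open>q\<close> the argument. The generating function is taken as the definition because later
  steps manipulate it as a polynomial.\<close>

definition krawtchouk :: "nat \<Rightarrow> nat \<Rightarrow> nat \<Rightarrow> real" where
  "krawtchouk n q j = coeff ([:1, -1:] ^ q * [:1, 1:] ^ (n - q)) j"

definition minuses :: "nat \<Rightarrow> (nat \<Rightarrow> real) \<Rightarrow> nat" where
  "minuses n x = card ({1..n} \<inter> {i. x i = -1})"

lemma minuses_le: "minuses n x \<le> n"
proof -
  have "minuses n x \<le> card {1..n}"
    unfolding minuses_def by (intro card_mono) auto
  then show ?thesis by simp
qed

lemma prod_monom: "(\<Prod>i\<in>A. monom (c i) (k i)) = monom (\<Prod>i\<in>A. c i) (\<Sum>i\<in>A. k i)"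
  by (induction A rule: infinite_finite_induct) (auto simp: mult_monom monom_0 one_pCons)

text \<open>Mark each coordinate equal to -1 by the variable y. The generating function over all
  levels then factorises, with 1 - y for coordinates in \<open>S\<close> and 1 + y for the
  others.\<close>

lemma sum_walsh_level:
  assumes "S \<subseteq> {1..n}"
  shows "(\<Sum>x | x \<in> cube n \<and> minuses n x = j. walsh S x) = krawtchouk n (card S) j"
proof -
  let ?f = "\<lambda>i (t::real). monom (if i \<in> S then t else 1) (if t = -1 then 1 else 0)"
  have "(\<Sum>x\<in>cube n. monom (walsh S x) (minuses n x)) = (\<Sum>x\<in>cube n. \<Prod>i\<in>{1..n}. ?f i (x i))"
    using assms
    by (intro sum.cong refl)
       (simp only: prod_monom walsh_eq_prod_if minuses_def,
        simp add: sum.If_cases)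
  also have "\<dots> = (\<Prod>i\<in>{1..n}. ?f i (-1) + ?f i 1)"
    by (rule sum_cube_prod)
  also have "\<dots> = (\<Prod>i\<in>{1..n}. if i \<in> S then [:1, -1:] else [:1, 1:])"
    by (intro prod.cong refl) (auto simp: monom_0 monom_Suc one_pCons)
  also have "\<dots> = [:1, -1:] ^ card S * [:1, 1:] ^ (n - card S)"
    using assms finite_subset[OF assms]
    by (subst prod.If_cases) (auto simp: Int_absorb1 Diff_eq [symmetric] card_Diff_subset)
  finally have "coeff (\<Sum>x\<in>cube n. monom (walsh S x) (minuses n x)) j = krawtchouk n (card S) j"
    by (simp add: krawtchouk_def)
  then show ?thesis
    by (simp add: coeff_sum sum.If_cases Collect_conj_eq Int_commute
          flip: sum.inter_filter)
qed

lemma sum_cube_minuses: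
  assumes "S \<subseteq> {1..n}"
  shows "(\<Sum>x\<in>cube n. walsh S x * f (minuses n x)) = (\<Sum>j\<le>n. krawtchouk n (card S) j * f j)"
proof -
  have "(\<Sum>x\<in>cube n. walsh S x * f (minuses n x))
      = (\<Sum>j\<le>n. \<Sum>x | x \<in> cube n \<and> minuses n x = j. walsh S x * f (minuses n x))"
    by (rule sum.group [symmetric]) (auto simp: minuses_le)
  also have "\<dots> = (\<Sum>j\<le>n. krawtchouk n (card S) j * f j)"
    by (intro sum.cong refl) (simp add: sum_walsh_level[OF assms, symmetric] sum_distrib_right)
  finally show ?thesis .
qed

text \<open>The dual count: \<open>x\<close> is fixed, y marks the elements of \<open>S\<close>, and
  the generating function is the product of the factors 1 + x_i y.\<close>

lemma sum_walsh_card: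
  assumes "x \<in> cube n"
  shows "(\<Sum>S | S \<subseteq> {1..n} \<and> card S = q. walsh S x) = krawtchouk n (minuses n x) q"
proof -
  have "(\<Prod>i\<in>{1..n}. monom (x i) 1 + 1) = (\<Sum>S\<in>Pow {1..n}. monom (walsh S x) (card S))"
    by (subst prod_add) (auto simp: prod_monom walsh_def)
  also have "(\<Prod>i\<in>{1..n}. monom (x i) 1 + 1) = (\<Prod>i\<in>{1..n}. if x i = -1 then [:1, -1:] else [:1, 1:])"
    using cube_cases[OF assms] by (intro prod.cong refl) (fastforce simp: monom_0 monom_Suc one_pCons)
  also have "\<dots> = [:1, -1:] ^ card ({1..n} \<inter> {i. x i = -1}) * [:1, 1:] ^ card ({1..n} - {i. x i = -1})"
    by (subst prod.If_cases) (auto simp: Diff_eq)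
  also have "card ({1..n} - {i. x i = -1}) = n - card ({1..n} \<inter> {i. x i = -1})"
    by (subst card_Diff_subset_Int) auto
  finally have "krawtchouk n (minuses n x) q = coeff (\<Sum>S\<in>Pow {1..n}. monom (walsh S x) (card S)) q"
    by (simp add: krawtchouk_def minuses_def)
  also have "\<dots> = (\<Sum>S | S \<subseteq> {1..n} \<and> card S = q. walsh S x)"
    by (simp add: coeff_sum Collect_conj_eq Pow_def sum.If_cases flip: sum.inter_filter)
  finally show ?thesis ..
qed

lemma krawtchouk_0: "krawtchouk n 0 j = real (n choose j)"
proof (cases "j \<le> n")
  case True
  then show ?thesis by (simp add: krawtchouk_def coeff_linear_poly_power)
next
  case False
  then show ?thesis
    by (simp add: krawtchouk_def coeff_eq_0 degree_linear_power binomial_eq_0)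
qed

lemma card_cube_level: "card {x \<in> cube n. minuses n x = j} = n choose j"
proof -
  have "real (card {x \<in> cube n. minuses n x = j}) = real (n choose j)"
    using sum_walsh_level[of "{}" n j] by (simp add: walsh_def krawtchouk_0)
  then show ?thesis by linarith
qed

text \<open>Double counting: both sides are the sum of \<open>walsh S x\<close> over all
  \<open>S\<close> of size \<open>q\<close> and all \<open>x\<close> at level
  \<open>j\<close>.\<close>

lemma krawtchouk_symmetry:
  "real (n choose q) * krawtchouk n q j = real (n choose j) * krawtchouk n j q"
proof -
  have "real (n choose q) * krawtchouk n q j
     = (\<Sum>S | S \<subseteq> {1..n} \<and> card S = q. krawtchouk n q j)"
    using n_subsets[of "{1..n}" q] by simp
  also have "\<dots> = (\<Sum>S | S \<subseteq> {1..n} \<and> card S = q. \<Sum>x | x \<in> cube n \<and> minuses n x = j. walsh S x)"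
    by (intro sum.cong refl) (auto simp: sum_walsh_level)
  also have "\<dots> = (\<Sum>x | x \<in> cube n \<and> minuses n x = j. \<Sum>S | S \<subseteq> {1..n} \<and> card S = q. walsh S x)"
    by (rule sum.swap)
  also have "\<dots> = (\<Sum>x | x \<in> cube n \<and> minuses n x = j. krawtchouk n j q)"
    by (intro sum.cong refl) (use sum_walsh_card in blast)
  finally show ?thesis by (simp add: card_cube_level)
qed

lemma Maj_minuses:
  assumes "x \<in> cube n"
  shows "Maj n x = sgn (real n - 2 * real (minuses n x))"
proof -
  have "(\<Sum>i=1..n. x i) = (\<Sum>i=1..n. if x i = -1 then -1 else 1)"
    using cube_cases[OF assms] by (intro sum.cong refl) fastforce
  also have "\<dots> = - real (card ({1..n} \<inter> {i. x i = -1})) + real (card ({1..n} - {i. x i = -1}))"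
    by (subst sum.If_cases) (auto simp: Diff_eq)
  also have "card ({1..n} - {i. x i = -1}) = n - card ({1..n} \<inter> {i. x i = -1})"
    by (subst card_Diff_subset_Int) auto
  also have "card ({1..n} \<inter> {i. x i = -1}) = minuses n x"
    by (simp add: minuses_def)
  finally show ?thesis
    using minuses_le[of n x] by (simp add: Maj_def)
qed

section \<open>Trigonometric averages on the circle\<close>


text \<open>This is B(a + 1/2, b + 1/2) / pi for the Beta function B. The form as a circle average
  makes it comparable with coefficient integrals.\<close>

definition beta_avg :: "nat \<Rightarrow> nat \<Rightarrow> real" where
  "beta_avg a b = integral {0..2 * pi} (\<lambda>t. ((sin (t / 2))\<^sup>2) ^ a * ((cos (t / 2))\<^sup>2) ^ b) / (2 * pi)"

lemma beta_avg_integrable: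
  "(\<lambda>t. ((sin (t / 2))\<^sup>2) ^ a * ((cos (t / 2))\<^sup>2) ^ b) integrable_on {0..2 * pi}"
  by (intro integrable_continuous_interval continuous_intros) auto

lemma has_integral_beta_avg:
  "((\<lambda>t. ((sin (t / 2))\<^sup>2) ^ a * ((cos (t / 2))\<^sup>2) ^ b) has_integral 2 * pi * beta_avg a b) {0..2 * pi}"
  using integrable_integral[OF beta_avg_integrable] by (simp add: beta_avg_def)

lemma beta_avg_0: "beta_avg 0 0 = 1"
  by (simp add: beta_avg_def)

lemma beta_avg_add: "beta_avg (Suc a) b + beta_avg a (Suc b) = beta_avg a b"
proof -
  have "integral {0..2 * pi} (\<lambda>t. ((sin (t / 2))\<^sup>2) ^ Suc a * ((cos (t / 2))\<^sup>2) ^ b)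
      + integral {0..2 * pi} (\<lambda>t. ((sin (t / 2))\<^sup>2) ^ a * ((cos (t / 2))\<^sup>2) ^ Suc b)
      = integral {0..2 * pi} (\<lambda>t. ((sin (t / 2))\<^sup>2) ^ Suc a * ((cos (t / 2))\<^sup>2) ^ b
          + ((sin (t / 2))\<^sup>2) ^ a * ((cos (t / 2))\<^sup>2) ^ Suc b)"
    by (rule integral_add [symmetric]) (rule beta_avg_integrable)+
  also have "(\<lambda>t::real. ((sin (t / 2))\<^sup>2) ^ Suc a * ((cos (t / 2))\<^sup>2) ^ b
          + ((sin (t / 2))\<^sup>2) ^ a * ((cos (t / 2))\<^sup>2) ^ Suc b)
        = (\<lambda>t. ((sin (t / 2))\<^sup>2 + (cos (t / 2))\<^sup>2) * (((sin (t / 2))\<^sup>2) ^ a * ((cos (t / 2))\<^sup>2) ^ b))"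
    by (simp only: power_Suc algebra_simps)
  finally show ?thesis
    by (simp add: beta_avg_def add_divide_distrib [symmetric])
qed

text \<open>Integration by parts: the difference of the two integrands is the derivative of
  \<open>?F\<close>, which vanishes at 0 and 2 pi. Combined with \<open>beta_avg_add\<close> it
  yields the one-step recurrences in \<open>a\<close> and in \<open>b\<close>.\<close>

lemma beta_avg_parts: "(2 * real a + 1) * beta_avg a (Suc b) = (2 * real b + 1) * beta_avg (Suc a) b"
proof -
  let ?F = "\<lambda>t::real. 2 * (sin (t / 2) ^ (2 * a + 1) * cos (t / 2) ^ (2 * b + 1))"
  let ?f = "\<lambda>t::real. (2 * real a + 1) * (((sin (t / 2))\<^sup>2) ^ a * ((cos (t / 2))\<^sup>2) ^ Suc b)
      - (2 * real b + 1) * (((sin (t / 2))\<^sup>2) ^ Suc a * ((cos (t / 2))\<^sup>2) ^ b)"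
  have "(?f has_integral (?F (2 * pi) - ?F 0)) {0..2 * pi}"
  proof (intro fundamental_theorem_of_calculus)
    fix t :: real
    have "(?F has_real_derivative ?f t) (at t within {0..2 * pi})"
      by (rule derivative_eq_intros refl | simp)+
         (simp add: power_mult algebra_simps power2_eq_square)
    then show "(?F has_vector_derivative ?f t) (at t within {0..2 * pi})"
      by (simp add: has_real_derivative_iff_has_vector_derivative)
  qed auto
  moreover have "(?f has_integral ((2 * real a + 1) * (2 * pi * beta_avg a (Suc b))
      - (2 * real b + 1) * (2 * pi * beta_avg (Suc a) b))) {0..2 * pi}"
    by (intro has_integral_diff has_integral_mult_right has_integral_beta_avg)
  ultimately have "(2 * real a + 1) * (2 * pi * beta_avg a (Suc b))
      - (2 * real b + 1) * (2 * pi * beta_avg (Suc a) b) = ?F (2 * pi) - ?F 0"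
    by (intro has_integral_unique)
  also have "?F (2 * pi) - ?F 0 = 0" by simp
  finally have "2 * pi * ((2 * real a + 1) * beta_avg a (Suc b) - (2 * real b + 1) * beta_avg (Suc a) b) = 0"
    by (simp add: algebra_simps)
  then show ?thesis by simp
qed

lemma beta_avg_Suc_left: "beta_avg (Suc a) b = (real a + 1/2) / (real a + real b + 1) * beta_avg a b"
proof -
  have "(real a + real b + 1) * beta_avg (Suc a) b = (real a + 1/2) * beta_avg a b"
    unfolding beta_avg_add [of a b, symmetric] using beta_avg_parts[of a b] by (simp add: algebra_simps)
  then show ?thesis by (simp add: field_simps)
qed

lemma beta_avg_Suc_right: "beta_avg a (Suc b) = (real b + 1/2) / (real a + real b + 1) * beta_avg a b"
proof -
  have "(real a + real b + 1) * beta_avg a (Suc b) = (real b + 1/2) * beta_avg a b"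
    unfolding beta_avg_add [of a b, symmetric] using beta_avg_parts[of a b] by (simp add: algebra_simps)
  then show ?thesis by (simp add: field_simps)
qed

lemma beta_avg_eq: "beta_avg a b = pochhammer (1/2) a * pochhammer (1/2) b / fact (a + b)"
proof (induction a)
  case 0
  show ?case
    by (induction b) (auto simp: beta_avg_0 beta_avg_Suc_right pochhammer_Suc add_ac mult_ac)
next
  case (Suc a)
  then show ?case
    by (simp add: beta_avg_Suc_left pochhammer_Suc add_ac mult_ac)
qed

lemma beta_avg_pos: "beta_avg a b > 0"
  by (simp add: beta_avg_eq pochhammer_pos)

section \<open>Extraction of polynomial coefficients by integration over a circle\<close>

lemma has_integral_cis_int:
  fixes m :: int
  shows "((\<lambda>t. cis (of_int m * t)) has_integral (if m = 0 then of_real (2 * pi) else 0)) {0..2 * pi}"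
proof (cases "m = 0")
  case True
  then show ?thesis using has_integral_const_real[of "1::complex" 0 "2 * pi"]
    by (simp add: cis_conv_exp scaleR_conv_of_real)
next
  case False
  let ?F = "\<lambda>t. cis (of_int m * t) / (\<i> * of_int m)"
  have "((\<lambda>t. cis (of_int m * t)) has_integral (?F (2 * pi) - ?F 0)) {0..2 * pi}"
  proof (intro fundamental_theorem_of_calculus)
    fix t :: real
    have "((\<lambda>z. exp (\<i> * of_int m * z) / (\<i> * of_int m)) has_field_derivative exp (\<i> * of_int m * of_real t))
            (at (of_real t))"
      using False by (auto intro!: derivative_eq_intros)
    then have "((\<lambda>t. exp (\<i> * of_int m * of_real t) / (\<i> * of_int m)) has_vector_derivative exp (\<i> * of_int m * of_real t))
            (at t within {0..2 * pi})"
      by (rule has_vector_derivative_real_field [THEN has_vector_derivative_at_within])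
    then show "(?F has_vector_derivative cis (of_int m * t)) (at t within {0..2 * pi})"
      by (simp add: cis_conv_exp mult_ac)
  qed auto
  moreover have "cis (of_int m * (2 * pi)) = 1"
    using cis_multiple_2pi[of "of_int m"] by (simp add: mult_ac)
  ultimately show ?thesis using False by simp
qed

lemma poly_coeff_circle:
  fixes p :: "complex poly" and R :: real
  shows "((\<lambda>t. poly p (of_real R * cis t) * cis (- (real j * t))) has_integral (2 * pi * coeff p j * R ^ j)) {0..2 * pi}"
proof -
  \<comment> \<open>The maximum guarantees that the index \<open>j\<close> occurs in the sum even
    beyond the degree, where its coefficient is 0.\<close>
  let ?d = "max j (degree p)"
  have "((\<lambda>t. \<Sum>i\<le>?d. coeff p i * of_real R ^ i * cis (of_int (int i - int j) * t)) has_integral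
         (\<Sum>i\<le>?d. coeff p i * of_real R ^ i * (if int i - int j = 0 then of_real (2 * pi) else 0))) {0..2 * pi}"
    by (intro has_integral_sum has_integral_mult_right has_integral_cis_int) auto
  moreover have "(\<Sum>i\<le>?d. coeff p i * of_real R ^ i * (if int i - int j = 0 then of_real (2 * pi) else 0))
      = (\<Sum>i\<le>?d. if i = j then coeff p i * of_real R ^ i * of_real (2 * pi) else 0)"
    by (intro sum.cong refl) auto
  moreover have "(\<lambda>t. \<Sum>i\<le>?d. coeff p i * of_real R ^ i * cis (of_int (int i - int j) * t))
     = (\<lambda>t. poly p (of_real R * cis t) * cis (- (real j * t)))"
  proof
    fix t
    have "poly p (of_real R * cis t) = (\<Sum>i\<le>?d. coeff p i * (of_real R * cis t) ^ i)"
      unfolding poly_altdef by (rule sum.mono_neutral_left) (auto simp: coeff_eq_0)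
    moreover have "cis (of_int (int i - int j) * t) = cis t ^ i * cis (- (real j * t))" for i
    proof -
      have "cis (of_int (int i - int j) * t) = cis (real i * t + - (real j * t))"
        by (simp add: left_diff_distrib)
      also have "\<dots> = cis (real i * t) * cis (- (real j * t))"
        by (rule cis_mult [symmetric])
      finally show ?thesis by (simp only: Complex.DeMoivre)
    qed
    ultimately show "(\<Sum>i\<le>?d. coeff p i * of_real R ^ i * cis (of_int (int i - int j) * t))
       = poly p (of_real R * cis t) * cis (- (real j * t))"
      by (simp add: sum_distrib_right power_mult_distrib mult.assoc)
  qed
  ultimately show ?thesis by (simp add: mult_ac)
qed

lemma map_poly_of_real_mult:
  fixes p q :: "real poly"
  shows "map_poly of_real (p * q) = (map_poly of_real p * map_poly of_real q :: complex poly)"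
  by (intro poly_eqI) (simp add: coeff_map_poly coeff_mult)

lemma map_poly_of_real_power:
  fixes p :: "real poly"
  shows "map_poly of_real (p ^ k) = (map_poly of_real p ^ k :: complex poly)"
  by (induction k) (auto simp: map_poly_of_real_mult)

section \<open>Tilted averages\<close>


text \<open>The quotient fact a / (1/2)_a grows like sqrt (pi a). The shift in 4 a + 1 is tuned to
  make the normalised square decreasing: after clearing denominators the two cubics in
  \<open>a\<close> differ by exactly 1.\<close>

lemma fact_over_pochhammer_half_mono:
  "(fact (Suc a) / pochhammer (1/2) (Suc a))\<^sup>2 / (4 * real (Suc a) + 1)
     \<le> (fact a / pochhammer (1/2) a :: real)\<^sup>2 / (4 * real a + 1)"
proof -
  define z :: real where "z = (fact a / pochhammer (1/2) a)\<^sup>2"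
  have z: "z \<ge> 0" by (simp add: z_def)
  have "(fact (Suc a) / pochhammer (1/2) (Suc a) :: real) = fact a / pochhammer (1/2) a * ((real a + 1) / (real a + 1/2))"
    by (simp add: pochhammer_Suc add_ac mult_ac)
  then have "(fact (Suc a) / pochhammer (1/2) (Suc a))\<^sup>2 / (4 * real (Suc a) + 1)
      = z * (((real a + 1) / (real a + 1/2))\<^sup>2 / (4 * real a + 5))"
    unfolding z_def power_mult_distrib [symmetric] times_divide_eq_right by (simp only: of_nat_Suc) simp
  also have "\<dots> \<le> z * (1 / (4 * real a + 1))"
  proof (intro mult_left_mono z)
    have "(2 * real a + 2)\<^sup>2 * (4 * real a + 1) \<le> (4 * real a + 5) * (2 * real a + 1)\<^sup>2"
      by (simp add: power2_eq_square algebra_simps)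
    then have "((2 * real a + 2) / (2 * real a + 1))\<^sup>2 / (4 * real a + 5) \<le> 1 / (4 * real a + 1)"
      by (simp add: divide_simps mult_ac)
    also have "(2 * real a + 2) / (2 * real a + 1) = (real a + 1) / (real a + 1/2)"
      by (simp add: field_simps)
    finally show "((real a + 1) / (real a + 1/2))\<^sup>2 / (4 * real a + 5) \<le> 1 / (4 * real a + 1)" .
  qed
  finally show ?thesis by (simp add: z_def)
qed

text \<open>By monotonicity the squared ratio is at most (4 a + 1) / (4 (a - d) + 1). A bound
  geometric in \<open>d\<close> is wanted, since powers can be absorbed into the bases of a
  trinomial expansion; Bernoulli's inequality provides it.\<close>

lemma fact_over_pochhammer_half_ratio:
  assumes "d \<le> a"
  shows "fact a / pochhammer (1/2) a \<le> 4 * (1 + 1 / sqrt (real a)) ^ d * (fact (a - d) / pochhammer (1/2) (a - d) :: real)"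
proof (cases "a = 0")
  case True
  with assms show ?thesis by simp
next
  case False
  let ?z = "\<lambda>a. fact a / pochhammer (1/2) a :: real"
  define \<epsilon> where "\<epsilon> = 1 / sqrt (real a)"
  have eps: "\<epsilon> > 0" "real a * \<epsilon>\<^sup>2 = 1"
    using False by (simp_all add: \<epsilon>_def power_divide)
  have "antimono (\<lambda>a. (?z a)\<^sup>2 / (4 * real a + 1))"
    by (intro decseq_SucI fact_over_pochhammer_half_mono)
  then have "(?z a)\<^sup>2 / (4 * real a + 1) \<le> (?z (a - d))\<^sup>2 / (4 * real (a - d) + 1)"
    by (rule antimonoD) simp
  moreover have "u \<le> s * (v / t)" if "u / v \<le> s / t" "v > 0" for u v s t :: real
    using that by (simp add: pos_divide_le_eq)
  ultimately have 1: "(?z a)\<^sup>2 \<le> (?z (a - d))\<^sup>2 * ((4 * real a + 1) / (4 * real (a - d) + 1))"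
    by simp
  have "1 + (real d * \<epsilon>)\<^sup>2 \<le> (1 + real d * \<epsilon>)\<^sup>2"
    using eps by (simp add: power2_eq_square algebra_simps)
  also have "\<dots> \<le> ((1 + \<epsilon>) ^ d)\<^sup>2"
    using eps by (intro power_mono Bernoulli_inequality) auto
  finally have 2: "1 + (real d * \<epsilon>)\<^sup>2 \<le> ((1 + \<epsilon>) ^ d)\<^sup>2" .
  \<comment> \<open>For 2 d \<le> a the quotient is bounded by a constant. Otherwise it is at most 4
    a + 1, and a = (a \<epsilon>)^2 \<le> 4 (d \<epsilon>)^2.\<close>
  have 3: "(4 * real a + 1) / (4 * real (a - d) + 1) \<le> 16 * (1 + (real d * \<epsilon>)\<^sup>2)"
  proof (cases "2 * d \<le> a")
    case True
    then have "4 * real a + 1 \<le> 16 * (4 * real (a - d) + 1)"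
      using assms by simp
    also have "\<dots> \<le> 16 * (1 + (real d * \<epsilon>)\<^sup>2) * (4 * real (a - d) + 1)"
      by (intro mult_right_mono) auto
    finally show ?thesis by (simp add: divide_le_eq)
  next
    case False
    then have "(real a)\<^sup>2 \<le> (2 * real d)\<^sup>2"
      by (intro power_mono) auto
    then have "(real a)\<^sup>2 * \<epsilon>\<^sup>2 \<le> (2 * real d)\<^sup>2 * \<epsilon>\<^sup>2"
      by (intro mult_right_mono) auto
    moreover have "(real a)\<^sup>2 * \<epsilon>\<^sup>2 = real a"
      using eps by (simp add: power2_eq_square)
    ultimately have "real a \<le> 4 * (real d * \<epsilon>)\<^sup>2"
      by (simp add: power_mult_distrib)
    moreover have "4 * real a + 1 \<le> 16 * (1 + w)" if "real a \<le> 4 * w" for w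
    proof -
      have "4 * real a \<le> 4 * (4 * w)"
        using that by (intro mult_left_mono) auto
      then show ?thesis by (simp add: distrib_left)
    qed
    ultimately have "4 * real a + 1 \<le> 16 * (1 + (real d * \<epsilon>)\<^sup>2)"
      by blast
    also have "\<dots> * 1 \<le> 16 * (1 + (real d * \<epsilon>)\<^sup>2) * (4 * real (a - d) + 1)"
      by (intro mult_left_mono) auto
    finally show ?thesis by (simp add: divide_le_eq)
  qed
  have "(?z a)\<^sup>2 \<le> (?z (a - d))\<^sup>2 * (16 * ((1 + \<epsilon>) ^ d)\<^sup>2)"
    by (rule order.trans[OF 1]) (use 2 3 in \<open>intro mult_left_mono, auto\<close>)
  also have "\<dots> = (4 * (1 + \<epsilon>) ^ d * ?z (a - d))\<^sup>2"
    by (simp only: power_mult_distrib) simp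
  finally show ?thesis
    unfolding \<epsilon>_def[symmetric]
    by (rule power2_le_imp_le) (use eps in \<open>auto intro!: mult_nonneg_nonneg divide_nonneg_nonneg pochhammer_nonneg\<close>)
qed

text \<open>With \<open>c\<close> collecting the common factors, the left side is
  \<open>c * (?z a * ?z b)\<close>, while \<open>c * (?z (a - d) * ?z (b - e))\<close> is the
  trinomial coefficient times \<open>beta_avg a b\<close>. The ratio bound is applied to each
  factor, and 16 = 4 * 4.\<close>

lemma choose_choose_beta_avg_le:
  assumes "d \<le> a" "e \<le> b"
  shows "real (a choose d) * real (b choose e) * beta_avg (a - d) (b - e)
     \<le> 16 * beta_avg a b * (fact (a + b) / (fact d * fact e * fact (a + b - d - e))
         * (1 + 1 / sqrt (real a)) ^ d * (1 + 1 / sqrt (real b)) ^ e)"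
proof -
  let ?P = "\<lambda>k. pochhammer (1/2) k :: real"
  let ?z = "\<lambda>a. fact a / ?P a :: real"
  have P: "?P k > 0" for k by (intro pochhammer_pos) auto
  define c where "c = ?P a * ?P b * ?P (a - d) * ?P (b - e)
     / (fact d * fact e * fact (a - d) * fact (b - e) * fact (a + b - d - e))"
  have c: "c \<ge> 0"
    unfolding c_def using P by (intro divide_nonneg_nonneg mult_nonneg_nonneg less_imp_le[OF P]) auto
  have eq: "a - d + (b - e) = a + b - d - e" using assms by simp
  have "real (a choose d) * real (b choose e) * beta_avg (a - d) (b - e) = c * (?z a * ?z b)"
    unfolding c_def beta_avg_eq eq using assms P[of a] P[of b]
    by (simp add: binomial_fact field_simps)
  also have "\<dots> \<le> c * ((4 * (1 + 1 / sqrt (real a)) ^ d * ?z (a - d)) * (4 * (1 + 1 / sqrt (real b)) ^ e * ?z (b - e)))"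
    using assms P
    by (intro mult_left_mono mult_mono fact_over_pochhammer_half_ratio c)
       (auto intro!: mult_nonneg_nonneg divide_nonneg_nonneg less_imp_le[OF P] add_nonneg_nonneg)
  also have "\<dots> = 16 * beta_avg a b * (fact (a + b) / (fact d * fact e * fact (a + b - d - e))
         * (1 + 1 / sqrt (real a)) ^ d * (1 + 1 / sqrt (real b)) ^ e)"
    unfolding c_def beta_avg_eq using P[of "a - d"] P[of "b - e"] by (simp add: mult_ac)
  finally show ?thesis .
qed

text \<open>The summands are those terms of the trinomial expansion with d \<le> a and e \<le> b;
  the omitted ones are nonnegative. Indexing by f = d + e exposes the expansion as two nested
  binomial theorems.\<close>

lemma sum_multinomial_le:
  fixes u v w :: real
  assumes "u \<ge> 0" "v \<ge> 0" "w \<ge> 0"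
  shows "(\<Sum>d\<le>a. \<Sum>e\<le>b. fact (a + b) / (fact d * fact e * fact (a + b - d - e)) * u ^ d * v ^ e * w ^ (a + b - d - e))
    \<le> (u + v + w) ^ (a + b)"
proof -
  define g where "g = (\<lambda>(f, d). real ((a + b) choose f) * real (f choose d) * u ^ d * v ^ (f - d) * w ^ (a + b - f))"
  have "(\<Sum>d\<le>a. \<Sum>e\<le>b. fact (a + b) / (fact d * fact e * fact (a + b - d - e)) * u ^ d * v ^ e * w ^ (a + b - d - e))
     = (\<Sum>(d, e)\<in>{..a} \<times> {..b}. fact (a + b) / (fact d * fact e * fact (a + b - d - e)) * u ^ d * v ^ e * w ^ (a + b - d - e))"
    by (simp add: sum.cartesian_product)
  also have "\<dots> = (\<Sum>(d, e)\<in>{..a} \<times> {..b}. g (d + e, d))"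
    by (intro sum.cong refl) (auto simp: g_def binomial_fact)
  also have "\<dots> = sum g ((\<lambda>(d, e). (d + e, d)) ` ({..a} \<times> {..b}))"
    by (subst sum.reindex) (auto simp: inj_on_def case_prod_unfold)
  also have "\<dots> \<le> sum g (SIGMA f:{..a + b}. {..f})"
    using assms by (intro sum_mono2) (auto simp: g_def)
  also have "\<dots> = (\<Sum>f\<le>a + b. \<Sum>d\<le>f. real ((a + b) choose f) * real (f choose d) * u ^ d * v ^ (f - d) * w ^ (a + b - f))"
    by (subst sum.Sigma) (auto simp: g_def)
  also have "\<dots> = (u + v + w) ^ (a + b)"
    by (simp add: binomial_ring[of "u + v" w] binomial_ring[of u v] sum_distrib_left sum_distrib_right mult_ac)
  finally show ?thesis .
qed

text \<open>For p = ((1 - R) / (1 + R))^2 with R > 0, the two bases are |1 - z|^2 / (1 + R)^2 and |1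
  + z|^2 / (1 + R)^2 at z = R \<open>cis t\<close>. The unit circle gives p = 0 and
  \<open>beta_avg\<close>.\<close>

definition tilted_avg :: "real \<Rightarrow> nat \<Rightarrow> nat \<Rightarrow> real" where
  "tilted_avg p a b = integral {0..2 * pi}
     (\<lambda>t. (p + (1 - p) * (sin (t / 2))\<^sup>2) ^ a * (p + (1 - p) * (cos (t / 2))\<^sup>2) ^ b) / (2 * pi)"

lemma tilted_avg_eq:
  "tilted_avg p a b = (\<Sum>d\<le>a. \<Sum>e\<le>b. real (a choose d) * real (b choose e)
     * p ^ (d + e) * (1 - p) ^ ((a - d) + (b - e)) * beta_avg (a - d) (b - e))"
proof -
  have "((\<lambda>t. \<Sum>d\<le>a. \<Sum>e\<le>b. (real (a choose d) * real (b choose e) * p ^ (d + e) * (1 - p) ^ ((a - d) + (b - e)))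
            * (((sin (t / 2))\<^sup>2) ^ (a - d) * ((cos (t / 2))\<^sup>2) ^ (b - e)))
     has_integral (\<Sum>d\<le>a. \<Sum>e\<le>b. (real (a choose d) * real (b choose e) * p ^ (d + e) * (1 - p) ^ ((a - d) + (b - e)))
            * (2 * pi * beta_avg (a - d) (b - e)))) {0..2 * pi}"
    by (intro has_integral_sum has_integral_mult_right has_integral_beta_avg) auto
  also have "(\<lambda>t. \<Sum>d\<le>a. \<Sum>e\<le>b. (real (a choose d) * real (b choose e) * p ^ (d + e) * (1 - p) ^ ((a - d) + (b - e)))
            * (((sin (t / 2))\<^sup>2) ^ (a - d) * ((cos (t / 2))\<^sup>2) ^ (b - e)))
     = (\<lambda>t. (p + (1 - p) * (sin (t / 2))\<^sup>2) ^ a * (p + (1 - p) * (cos (t / 2))\<^sup>2) ^ b)"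
    by (simp only: binomial_ring sum_product power_mult_distrib power_add mult_ac)
  finally show ?thesis
    by (simp add: tilted_avg_def integral_unique sum_divide_distrib mult_ac)
qed

text \<open>Termwise comparison with the trinomial expansion gives the factor (p x + p y + 1 - p)^(a
  + b), which is at most exp (p (a + b) (x + y - 1)). The hypothesis on \<open>r\<close> bounds this
  by exp (p r), and (1 - p)^r \<le> exp (- p r) cancels it.\<close>

lemma tilted_avg_le:
  assumes p: "0 \<le> p" "p \<le> 1"
    and r: "real r \<ge> real (a + b) * (1 + 1 / sqrt (real a) + 1 / sqrt (real b))"
  shows "(1 - p) ^ r * tilted_avg p a b \<le> 16 * beta_avg a b"
proof -
  define x where "x = 1 + 1 / sqrt (real a)"
  define y where "y = 1 + 1 / sqrt (real b)"
  have xy: "x \<ge> 0" "y \<ge> 0" by (auto simp: x_def y_def)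
  then have pxy: "p * x \<ge> 0" "p * y \<ge> 0" using p by auto
  have "tilted_avg p a b \<le> (\<Sum>d\<le>a. \<Sum>e\<le>b. 16 * beta_avg a b *
     (fact (a + b) / (fact d * fact e * fact (a + b - d - e)) * (p * x) ^ d * (p * y) ^ e * (1 - p) ^ (a + b - d - e)))"
    unfolding tilted_avg_eq
  proof (intro sum_mono)
    fix d e assume de: "d \<in> {..a}" "e \<in> {..b}"
    have "real (a choose d) * real (b choose e) * beta_avg (a - d) (b - e) * (p ^ (d + e) * (1 - p) ^ ((a - d) + (b - e)))
      \<le> 16 * beta_avg a b * (fact (a + b) / (fact d * fact e * fact (a + b - d - e)) * x ^ d * y ^ e) * (p ^ (d + e) * (1 - p) ^ ((a - d) + (b - e)))"
      using de p unfolding x_def y_def by (intro mult_right_mono choose_choose_beta_avg_le) auto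
    moreover have "(a - d) + (b - e) = a + b - d - e" using de by simp
    ultimately show "real (a choose d) * real (b choose e) * p ^ (d + e) * (1 - p) ^ ((a - d) + (b - e)) * beta_avg (a - d) (b - e)
      \<le> 16 * beta_avg a b * (fact (a + b) / (fact d * fact e * fact (a + b - d - e)) * (p * x) ^ d * (p * y) ^ e * (1 - p) ^ (a + b - d - e))"
      by (simp add: power_mult_distrib power_add mult_ac)
  qed
  also have "\<dots> = 16 * beta_avg a b * (\<Sum>d\<le>a. \<Sum>e\<le>b.
     (fact (a + b) / (fact d * fact e * fact (a + b - d - e)) * (p * x) ^ d * (p * y) ^ e * (1 - p) ^ (a + b - d - e)))"
    by (simp add: sum_distrib_left)
  also have "\<dots> \<le> 16 * beta_avg a b * (p * x + p * y + (1 - p)) ^ (a + b)"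
    using p xy less_imp_le[OF beta_avg_pos] by (intro mult_left_mono sum_multinomial_le) auto
  also have "\<dots> \<le> 16 * beta_avg a b * exp (p * (x + y - 1)) ^ (a + b)"
    using exp_ge_add_one_self[of "p * (x + y - 1)"] p pxy less_imp_le[OF beta_avg_pos]
    by (intro mult_left_mono power_mono) (auto simp: algebra_simps)
  also have "exp (p * (x + y - 1)) ^ (a + b) = exp (p * (real (a + b) * (x + y - 1)))"
    by (subst exp_of_nat_mult [symmetric]) (simp add: mult_ac)
  also have "16 * beta_avg a b * exp (p * (real (a + b) * (x + y - 1))) \<le> 16 * beta_avg a b * exp (p * real r)"
    using r p less_imp_le[OF beta_avg_pos]
    by (intro mult_left_mono exp_mono) (auto simp: x_def y_def add.assoc)
  finally have "tilted_avg p a b \<le> 16 * beta_avg a b * exp (p * real r)" .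
  then have "(1 - p) ^ r * tilted_avg p a b \<le> exp (-p) ^ r * (16 * beta_avg a b * exp (p * real r))"
    using p exp_ge_add_one_self[of "-p"] less_imp_le[OF beta_avg_pos, of a b]
    by (intro order.trans[OF mult_left_mono mult_right_mono] power_mono) auto
  also have "\<dots> = 16 * beta_avg a b"
    by (simp only: exp_of_nat_mult [symmetric]) (simp add: mult_exp_exp mult_ac)
  finally show ?thesis .
qed

section \<open>A lower bound for binomial coefficients\<close>


text \<open>At x = 1 / n the lower bound equals 1 / (n + 1/2), precisely what makes the Stirling
  defect nonincreasing.\<close>

lemma ln_one_plus_ge:
  assumes "x \<ge> (0::real)"
  shows "2 * x / (2 + x) \<le> ln (1 + x)"
proof -
  let ?f = "\<lambda>x::real. ln (1 + x) - 2 * x / (2 + x)"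
  have "?f 0 \<le> ?f x"
  proof (rule DERIV_nonneg_imp_nondecreasing[OF assms])
    fix y :: real assume "0 \<le> y" "y \<le> x"
    then show "\<exists>z. (?f has_real_derivative z) (at y) \<and> 0 \<le> z"
    proof (intro exI conjI)
      have "(?f has_real_derivative 1 / (1 + y) - (2 * (2 + y) - 2 * y) / ((2 + y) * (2 + y))) (at y)"
        using \<open>0 \<le> y\<close> by (auto intro!: derivative_eq_intros)
      also have "1 / (1 + y) - (2 * (2 + y) - 2 * y) / ((2 + y) * (2 + y)) = y\<^sup>2 / ((1 + y) * (2 + y)\<^sup>2)"
        using \<open>0 \<le> y\<close> by (simp add: divide_simps) (simp add: power2_eq_square algebra_simps)
      finally show "(?f has_real_derivative y\<^sup>2 / ((1 + y) * (2 + y)\<^sup>2)) (at y)" .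
    qed (use \<open>0 \<le> y\<close> in auto)
  qed
  then show ?thesis by simp
qed

text \<open>At x = 1 / n, multiplied by n + 1/2, the upper bound is 1 + 1 / (4 n) - 1 / (4 (n + 1)),
  so the decrements of the Stirling defect telescope.\<close>

lemma ln_one_plus_le:
  assumes "x \<ge> (0::real)"
  shows "ln (1 + x) \<le> x * (2 + x) / (2 * (1 + x))"
proof -
  let ?f = "\<lambda>x::real. x * (2 + x) / (2 * (1 + x)) - ln (1 + x)"
  have "?f 0 \<le> ?f x"
  proof (rule DERIV_nonneg_imp_nondecreasing[OF assms])
    fix y :: real assume "0 \<le> y" "y \<le> x"
    then show "\<exists>z. (?f has_real_derivative z) (at y) \<and> 0 \<le> z"
    proof (intro exI conjI)
      have "(?f has_real_derivative ((2 + y + y) * (2 * (1 + y)) - y * (2 + y) * 2) / ((2 * (1 + y)) * (2 * (1 + y))) - 1 / (1 + y)) (at y)"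
        using \<open>0 \<le> y\<close> by (auto intro!: derivative_eq_intros)
      also have "((2 + y + y) * (2 * (1 + y)) - y * (2 + y) * 2) / ((2 * (1 + y)) * (2 * (1 + y))) - 1 / (1 + y) = y\<^sup>2 / (2 * (1 + y)\<^sup>2)"
        using \<open>0 \<le> y\<close> by (simp add: divide_simps) (simp add: power2_eq_square algebra_simps)
      finally show "(?f has_real_derivative y\<^sup>2 / (2 * (1 + y)\<^sup>2)) (at y)" .
    qed (use \<open>0 \<le> y\<close> in auto)
  qed
  then show ?thesis by simp
qed

text \<open>The logarithm of n! / (n^(n + 1/2) exp (- n)). It starts at 1 for n = 1 and decreases by
  at most 1/4 in total.\<close>

definition stirling_defect :: "nat \<Rightarrow> real" where
  "stirling_defect n = ln (fact n) + real n - (real n + 1/2) * ln (real n)"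

lemma stirling_defect_diff:
  assumes "n \<ge> 1"
  shows "stirling_defect n - stirling_defect (Suc n) = (real n + 1/2) * ln (1 + 1 / real n) - 1"
proof -
  have e1: "ln (real (Suc n)) = ln (real n) + ln (1 + 1 / real n)"
  proof -
    have "1 + 1 / real n > 0" by (simp add: add_pos_nonneg)
    then show ?thesis
      using assms ln_mult_pos[of "real n" "1 + 1 / real n"] by (simp add: distrib_left add_ac)
  qed
  have e2: "ln (fact (Suc n) :: real) = ln (fact n) + ln (real (Suc n))"
    by (simp add: ln_mult)
  show ?thesis
    unfolding stirling_defect_def e2 e1 by (simp add: algebra_simps)
qed

lemma stirling_defect_le: "n \<ge> 1 \<Longrightarrow> stirling_defect n \<le> 1"
proof (induction n rule: nat_induct_at_least)
  case base
  then show ?case by (simp add: stirling_defect_def)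
next
  case (Suc n)
  have "1 \<le> (real n + 1/2) * (2 * (1 / real n) / (2 + 1 / real n))"
    using Suc.hyps by (simp add: field_simps)
  also have "\<dots> \<le> (real n + 1/2) * ln (1 + 1 / real n)"
    by (intro mult_left_mono ln_one_plus_ge) auto
  finally show ?case
    using stirling_defect_diff[OF Suc.hyps] Suc.IH by linarith
qed

lemma stirling_defect_ge: "n \<ge> 1 \<Longrightarrow> stirling_defect n \<ge> 3/4 + 1 / (4 * real n)"
proof (induction n rule: nat_induct_at_least)
  case base
  then show ?case by (simp add: stirling_defect_def)
next
  case (Suc n)
  have "(real n + 1/2) * ln (1 + 1 / real n) \<le> (real n + 1/2) * (1 / real n * (2 + 1 / real n) / (2 * (1 + 1 / real n)))"
    by (intro mult_left_mono ln_one_plus_le) auto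
  also have "\<dots> = 1 + (1 / (4 * real n) - 1 / (4 * real (Suc n)))"
  proof -
    have "(x + 1/2) * (1 / x * (2 + 1 / x) / (2 * (1 + 1 / x))) = 1 + (1 / (4 * x) - 1 / (4 * (x + 1)))"
      if "x > 0" for x :: real
    proof -
      have "1 / x * (2 + 1 / x) / (2 * (1 + 1 / x)) = (2 * x + 1) / (2 * x * (x + 1))"
        using that by (simp add: divide_simps)
      then show ?thesis
        using that by (simp add: divide_simps) (simp add: algebra_simps)
    qed
    from this[of "real n"] show ?thesis using Suc.hyps by (simp add: add_ac)
  qed
  finally show ?case
    using stirling_defect_diff[OF Suc.hyps] Suc.IH by linarith
qed

text \<open>Stirling's bounds leave the factor sqrt (n / (j k)) with k = n - j, and j k \<le> n^2 /
  4 makes it at least 2 / sqrt n.\<close>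

lemma binomial_ge_entropy:
  assumes "1 \<le> j" "j < n"
  shows "real n ^ n \<le> 2 * sqrt (real n) * real (n choose j) * real j ^ j * real (n - j) ^ (n - j)"
proof -
  define k where "k = n - j"
  have k: "k \<ge> 1" "n = j + k" using assms by (auto simp: k_def)
  have fact_bounds: "ln (fact n) = stirling_defect n - real n + (real n + 1/2) * ln (real n)" for n
    by (simp add: stirling_defect_def)
  have choose: "real (n choose j) = fact n / (fact j * fact k)"
    using k by (simp add: binomial_fact)
  have c_pos: "real (n choose j) > 0" using assms by simp
  have "ln (real (n choose j)) = ln (fact n) - ln (fact j) - ln (fact k)"
    unfolding choose by (simp add: ln_div ln_mult)
  moreover have "ln (fact n) - ln (fact j) - ln (fact k) \<ge> 3/4 - 1 - 1 + (real n + 1/2) * ln (real n) - (real j + 1/2) * ln (real j) - (real k + 1/2) * ln (real k)"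
  proof -
    have "3/4 \<le> stirling_defect n"
    proof -
      have "0 \<le> 1 / (4 * real n)" by simp
      then show ?thesis using stirling_defect_ge[of n] assms by linarith
    qed
    then show ?thesis
      unfolding fact_bounds[of n] fact_bounds[of j] fact_bounds[of k]
      using stirling_defect_le[of j] stirling_defect_le[of k] k assms by simp
  qed
  ultimately have 1: "ln (real (n choose j)) \<ge> - 5/4 + (real n + 1/2) * ln (real n) - (real j + 1/2) * ln (real j) - (real k + 1/2) * ln (real k)"
    by simp
  have "4 * (real j * real k) \<le> (real n)\<^sup>2"
    using k sum_squares_bound[of "real j" "real k"] by (simp add: power2_eq_square algebra_simps)
  then have "ln (4 * (real j * real k)) \<le> ln ((real n)\<^sup>2)"
    using k assms by (subst ln_le_cancel_iff) auto
  then have 2: "ln 4 + ln (real j) + ln (real k) \<le> 2 * ln (real n)"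
    using k assms by (simp add: ln_mult ln_realpow)
  have ln4: "ln (4::real) = 2 * ln 2"
    using ln_realpow[of "2::real" 2] by simp
  \<comment> \<open>The Stirling bounds lose 5/4 = 1 + 1 - 3/4. This is covered by 2 ln 2 \<ge> 4/3:
    one ln 2 stems from j k \<le> n^2 / 4, the other from the factor 2 in the claim.\<close>
  have "2 / 3 \<le> ln (2::real)"
    using ln_one_plus_ge[of 1] by simp
  then have 3: "real n * ln (real n) \<le> ln 2 + ln (real n) / 2 + ln (real (n choose j)) + real j * ln (real j) + real k * ln (real k)"
    using 1 2 ln4 by (simp add: algebra_simps)
  have "ln (real n ^ n) \<le> ln (2 * sqrt (real n) * real (n choose j) * real j ^ j * real k ^ k)"
    using 3 k assms c_pos by (simp add: ln_mult ln_realpow ln_sqrt)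
  then show ?thesis
    using k assms c_pos unfolding k_def[symmetric] by (subst (asm) ln_le_cancel_iff) auto
qed

section \<open>Fourier coefficients of the majority function\<close>


lemma one_minus_cis_squared: "(1 - cis t)\<^sup>2 = of_real (- 4 * (sin (t / 2))\<^sup>2) * cis t"
proof -
  define u where "u = t / 2"
  have t: "t = 2 * u" by (simp add: u_def)
  have "1 - cis t = - 2 * \<i> * of_real (sin u) * cis u"
    unfolding t by (simp add: complex_eq_iff sin_double cos_double_sin power2_eq_square)
  moreover have "cis t = (cis u)\<^sup>2"
    unfolding t Complex.DeMoivre by simp
  ultimately show ?thesis
    by (simp add: u_def power_mult_distrib)
qed

lemma one_plus_cis_squared: "(1 + cis t)\<^sup>2 = of_real (4 * (cos (t / 2))\<^sup>2) * cis t"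
proof -
  have "(1 + cis t)\<^sup>2 = (1 - cis t)\<^sup>2 + 4 * cis t"
    by (simp add: power2_eq_square algebra_simps)
  also have "\<dots> = of_real (4 * (1 - (sin (t / 2))\<^sup>2)) * cis t"
    by (simp add: one_minus_cis_squared algebra_simps)
  also have "1 - (sin (t / 2))\<^sup>2 = (cos (t / 2))\<^sup>2"
    by (simp add: cos_squared_eq)
  finally show ?thesis .
qed

text \<open>On the unit circle (1 - z)^2 and (1 + z)^2 are real multiples of z. At the central index
  the oscillating factors cancel, and the coefficient integral becomes a real multiple of the one in
  \<open>beta_avg\<close>.\<close>

lemma central_coeff:
  "coeff ([:1, -1:] ^ (2 * a) * [:1, 1:] ^ (2 * b)) (a + b) = (-1) ^ a * 4 ^ (a + b) * beta_avg a b"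
proof -
  define p :: "real poly" where "p = [:1, -1:] ^ (2 * a) * [:1, 1:] ^ (2 * b)"
  define P :: "complex poly" where "P = map_poly of_real p"
  have P: "poly P z = ((1 - z)\<^sup>2) ^ a * ((1 + z)\<^sup>2) ^ b" for z
    by (simp add: P_def p_def map_poly_of_real_mult map_poly_of_real_power map_poly_pCons power_mult)
  have eq: "poly P (of_real 1 * cis t) * cis (- (real (a + b) * t))
      = of_real ((-4) ^ a * 4 ^ b * (((sin (t / 2))\<^sup>2) ^ a * ((cos (t / 2))\<^sup>2) ^ b))" for t
  proof -
    have "cis (- (real (a + b) * t)) * cis t ^ (a + b) = 1"
      by (simp only: Complex.DeMoivre cis_mult) simp
    then have 1: "cis (- (real (a + b) * t)) * (cis t ^ a * cis t ^ b) = 1"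
      by (simp only: power_add)
    have "poly P (of_real 1 * cis t) * cis (- (real (a + b) * t))
      = of_real (- 4 * (sin (t / 2))\<^sup>2) ^ a * of_real (4 * (cos (t / 2))\<^sup>2) ^ b
          * (cis (- (real (a + b) * t)) * (cis t ^ a * cis t ^ b))"
      unfolding P by (simp only: of_real_1 mult_1_left one_minus_cis_squared one_plus_cis_squared power_mult_distrib mult_ac)
    then show ?thesis
      unfolding 1 by (simp only: of_real_power [symmetric] power_mult_distrib of_real_mult [symmetric]) (simp add: mult_ac)
  qed
  have "((\<lambda>t. poly P (of_real 1 * cis t) * cis (- (real (a + b) * t))) has_integral
      (2 * pi * coeff P (a + b) * of_real 1 ^ (a + b))) {0..2 * pi}"
    using poly_coeff_circle[of P 1 "a + b"] by simp
  moreover have "((\<lambda>t. poly P (of_real 1 * cis t) * cis (- (real (a + b) * t))) has_integral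
      of_real ((-4) ^ a * 4 ^ b * (2 * pi * beta_avg a b))) {0..2 * pi}"
    unfolding eq by (intro has_integral_of_real has_integral_mult_right has_integral_beta_avg)
  ultimately have "2 * pi * coeff P (a + b) * of_real 1 ^ (a + b) = of_real ((-4) ^ a * 4 ^ b * (2 * pi * beta_avg a b))"
    by (rule has_integral_unique)
  then have "complex_of_real (2 * pi * coeff p (a + b)) = of_real (2 * pi * ((-4) ^ a * 4 ^ b * beta_avg a b))"
    by (simp add: P_def coeff_map_poly mult_ac)
  then have "2 * pi * coeff p (a + b) = 2 * pi * ((-4) ^ a * 4 ^ b * beta_avg a b)"
    by (simp only: of_real_eq_iff)
  moreover have "(-4) ^ a = ((-1) ^ a * 4 ^ a :: real)"
    by (simp add: power_mult_distrib [symmetric])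
  ultimately show ?thesis
    by (simp add: p_def power_add)
qed

lemma sum_coeff_one_minus_mult:
  fixes R :: "real poly"
  shows "(\<Sum>j\<le>N. coeff ([:1, -1:] * R) j) = coeff R N"
  by (induction N) (auto simp: coeff_pCons)

text \<open>As \<open>card S\<close> is odd, the generating polynomial has a factor 1 - y. Its value
  at 1 is 0, so the upper half of the coefficients sums to minus the lower half; the lower half
  telescopes to the central coefficient of \<open>R\<close>. The two halves account for 2 * 4^N =
  2^n.\<close>

lemma sum_walsh_Maj:
  assumes n: "n = 2 * N + 1" and S: "S \<subseteq> {1..n}" "card S = 2 * i + 1"
  shows "(\<Sum>x\<in>cube n. walsh S x * Maj n x) = 2 ^ n * (-1) ^ i * beta_avg i (N - i)"
proof -
  have "card S \<le> n" using card_mono[OF _ S(1)] by simp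
  then have i: "i \<le> N" using S n by simp
  let ?K = "krawtchouk n (2 * i + 1)"
  define R :: "real poly" where "R = [:1, -1:] ^ (2 * i) * [:1, 1:] ^ (2 * (N - i))"
  have K: "?K j = coeff ([:1, -1:] * R) j" for j
  proof -
    have "n - (2 * i + 1) = 2 * (N - i)" using n by simp
    then show ?thesis unfolding krawtchouk_def R_def by (simp only: power_add power_one_right mult_ac)
  qed
  have half: "(\<Sum>j\<le>N. ?K j) = (-1) ^ i * 4 ^ N * beta_avg i (N - i)"
    unfolding K sum_coeff_one_minus_mult unfolding R_def using central_coeff[of i "N - i"] i by simp
  have "degree ([:1, -1:] * R) \<le> n"
    unfolding R_def
    by (rule order.trans[OF degree_mult_le order.trans[OF add_mono[OF order.refl degree_mult_le]]])
       (use n i in \<open>simp add: degree_linear_power\<close>)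
  then have "poly ([:1, -1:] * R) 1 = (\<Sum>j\<le>n. coeff ([:1, -1:] * R) j * 1 ^ j)"
    unfolding poly_altdef
    by (intro sum.mono_neutral_left) (auto simp: coeff_eq_0 simp del: mult_pCons_left)
  then have total: "(\<Sum>j\<le>n. ?K j) = 0"
    unfolding K by (simp del: mult_pCons_left)
  have split: "{..n} = {..N} \<union> {N<..n}" using n by auto
  have upper: "(\<Sum>j\<in>{N<..n}. ?K j) = - (\<Sum>j\<le>N. ?K j)"
    using total unfolding split by (subst (asm) sum.union_disjoint) auto
  have "(\<Sum>x\<in>cube n. walsh S x * Maj n x) = (\<Sum>x\<in>cube n. walsh S x * sgn (real n - 2 * real (minuses n x)))"
    by (intro sum.cong refl) (simp add: Maj_minuses)
  also have "\<dots> = (\<Sum>j\<le>n. ?K j * sgn (real n - 2 * real j))"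
    using sum_cube_minuses[OF S(1), of "\<lambda>j. sgn (real n - 2 * real j)"] S(2) by simp
  also have "\<dots> = (\<Sum>j\<le>N. ?K j * sgn (real n - 2 * real j)) + (\<Sum>j\<in>{N<..n}. ?K j * sgn (real n - 2 * real j))"
    unfolding split by (rule sum.union_disjoint) auto
  also have "(\<Sum>j\<le>N. ?K j * sgn (real n - 2 * real j)) = (\<Sum>j\<le>N. ?K j)"
    by (intro sum.cong refl) (use n in \<open>auto simp: sgn_if\<close>)
  also have "(\<Sum>j\<in>{N<..n}. ?K j * sgn (real n - 2 * real j)) = - (\<Sum>j\<in>{N<..n}. ?K j)"
    unfolding sum_negf [symmetric] by (intro sum.cong refl) (use n in \<open>auto simp: sgn_if\<close>)
  finally show ?thesis
    unfolding upper half using n by (simp add: power_mult)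
qed

section \<open>The test function\<close>


text \<open>Given by its Walsh expansion, from which orthogonality and pairings are immediate;
  pointwise values come from \<open>test_fun_eq_coeff\<close>. Dividing by the number of sets at a
  level cancels that number in pairings with symmetric functions.\<close>

definition test_fun :: "nat \<Rightarrow> nat \<Rightarrow> nat \<Rightarrow> (nat \<Rightarrow> real) \<Rightarrow> real" where
  "test_fun n k r x = (\<Sum>i\<le>r. (-1) ^ i * real (r choose i) / real (n choose (k + 2 * i))
     * (\<Sum>S | S \<subseteq> {1..n} \<and> card S = k + 2 * i. walsh S x))"

lemma sum_test_fun_mult:
  "(\<Sum>x\<in>cube n. test_fun n k r x * F x) = (\<Sum>i\<le>r. (-1) ^ i * real (r choose i) / real (n choose (k + 2 * i))
     * (\<Sum>S | S \<subseteq> {1..n} \<and> card S = k + 2 * i. \<Sum>x\<in>cube n. walsh S x * F x))"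
proof -
  have "(\<Sum>x\<in>cube n. test_fun n k r x * F x)
     = (\<Sum>x\<in>cube n. \<Sum>i\<le>r. \<Sum>S | S \<subseteq> {1..n} \<and> card S = k + 2 * i.
          (-1) ^ i * real (r choose i) / real (n choose (k + 2 * i)) * (walsh S x * F x))"
    by (intro sum.cong refl) (simp add: test_fun_def sum_distrib_left sum_distrib_right mult.assoc)
  also have "\<dots> = (\<Sum>i\<le>r. \<Sum>S | S \<subseteq> {1..n} \<and> card S = k + 2 * i. \<Sum>x\<in>cube n.
          (-1) ^ i * real (r choose i) / real (n choose (k + 2 * i)) * (walsh S x * F x))"
    by (subst sum.swap) (intro sum.cong refl sum.swap)
  finally show ?thesis
    by (simp only: sum_distrib_left)
qed

lemma sum_test_fun_walsh:
  assumes "T \<subseteq> {1..n}" "card T < k"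
  shows "(\<Sum>x\<in>cube n. test_fun n k r x * walsh T x) = 0"
proof -
  have "(\<Sum>x\<in>cube n. walsh S x * walsh T x) = 0" if "S \<in> {S. S \<subseteq> {1..n} \<and> card S = k + 2 * i}" for S i
    using that assms by (subst sum_walsh_walsh) auto
  then have "(\<Sum>S | S \<subseteq> {1..n} \<and> card S = k + 2 * i. \<Sum>x\<in>cube n. walsh S x * walsh T x) = 0" for i
    by (intro sum.neutral) blast
  then show ?thesis
    unfolding sum_test_fun_mult by simp
qed

lemma sum_test_fun_poly:
  assumes "p \<in> multilinear_polys n m" "m < k"
  shows "(\<Sum>x\<in>cube n. test_fun n k r x * p x) = 0"
proof -
  obtain a where p: "p = (\<lambda>x. \<Sum>S | S \<subseteq> {1..n} \<and> card S \<le> m. a S * walsh S x)"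
    using assms(1) by (auto simp: multilinear_polys_def walsh_def)
  have "(\<Sum>x\<in>cube n. test_fun n k r x * p x)
      = (\<Sum>S | S \<subseteq> {1..n} \<and> card S \<le> m. a S * (\<Sum>x\<in>cube n. test_fun n k r x * walsh S x))"
    unfolding p sum_distrib_left by (subst sum.swap) (simp add: mult.left_commute)
  also have "\<dots> = 0"
    using assms(2) by (intro sum.neutral) (auto simp: sum_test_fun_walsh)
  finally show ?thesis .
qed

text \<open>The sign (-1)^i of the test function meets (-1)^(M + i) from Majority, so all levels add
  up with the same sign (-1)^M.\<close>

lemma sum_test_fun_noise_Maj:
  assumes \<rho>: "0 < \<rho>" "\<rho> < 1" and n: "n = 2 * (M + L + r) + 1"
  shows "(\<Sum>x\<in>cube n. test_fun n (2 * M + 1) r x * noise_op n \<rho> (Maj n) x)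
    = 2 ^ n * (-1) ^ M * \<rho> ^ (2 * M + 1)
        * (\<Sum>i\<le>r. real (r choose i) * (\<rho>\<^sup>2) ^ i * beta_avg (M + i) (L + (r - i)))"
proof -
  have "(\<Sum>x\<in>cube n. test_fun n (2 * M + 1) r x * noise_op n \<rho> (Maj n) x)
     = (\<Sum>i\<le>r. 2 ^ n * (-1) ^ M * \<rho> ^ (2 * M + 1) * (real (r choose i) * (\<rho>\<^sup>2) ^ i * beta_avg (M + i) (L + (r - i))))"
    unfolding sum_test_fun_mult
  proof (intro sum.cong refl)
    fix i assume i: "i \<in> {..r}"
    let ?q = "2 * M + 1 + 2 * i"
    have "(\<Sum>S | S \<subseteq> {1..n} \<and> card S = ?q. \<Sum>x\<in>cube n. walsh S x * noise_op n \<rho> (Maj n) x)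
       = (\<Sum>S | S \<subseteq> {1..n} \<and> card S = ?q. \<rho> ^ ?q * (2 ^ n * (-1) ^ (M + i) * beta_avg (M + i) (L + (r - i))))"
    proof (intro sum.cong refl)
      fix S assume S: "S \<in> {S. S \<subseteq> {1..n} \<and> card S = ?q}"
      have "M + L + r - (M + i) = L + (r - i)" using i by simp
      then show "(\<Sum>x\<in>cube n. walsh S x * noise_op n \<rho> (Maj n) x)
        = \<rho> ^ ?q * (2 ^ n * (-1) ^ (M + i) * beta_avg (M + i) (L + (r - i)))"
        using S sum_walsh_noise_op[OF \<rho>, of S n "Maj n"] sum_walsh_Maj[OF n, of S "M + i"] by simp
    qed
    also have "\<dots> = real (n choose ?q) * (\<rho> ^ ?q * (2 ^ n * (-1) ^ (M + i) * beta_avg (M + i) (L + (r - i))))"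
      using n_subsets[of "{1..n}" ?q] by simp
    finally have sum_eq: "(\<Sum>S | S \<subseteq> {1..n} \<and> card S = ?q. \<Sum>x\<in>cube n. walsh S x * noise_op n \<rho> (Maj n) x)
      = real (n choose ?q) * (\<rho> ^ ?q * (2 ^ n * (-1) ^ (M + i) * beta_avg (M + i) (L + (r - i))))" .
    have "?q \<le> n" using i n by simp
    then have choose_pos: "real (n choose ?q) > 0"
      by (simp only: of_nat_0_less_iff zero_less_binomial_iff)
    define e :: real where "e = (-1) ^ i"
    have e: "e * e = 1" "(-1) ^ (M + i) = (-1) ^ M * e"
      by (simp_all add: e_def power_add flip: power_mult_distrib)
    have \<rho>_power: "\<rho> ^ ?q = \<rho> ^ (2 * M + 1) * (\<rho>\<^sup>2) ^ i"
      by (simp only: power_add power_mult)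
    have id: "e * R / C * (C * (P * Q * (T * (E * e) * B))) = (e * e) * (T * E * P * (R * Q * B))"
      if "C > 0" for R C P Q T E B :: real
      using that by (simp add: field_simps)
    show "(-1) ^ i * real (r choose i) / real (n choose ?q)
       * (\<Sum>S | S \<subseteq> {1..n} \<and> card S = ?q. \<Sum>x\<in>cube n. walsh S x * noise_op n \<rho> (Maj n) x)
      = 2 ^ n * (-1) ^ M * \<rho> ^ (2 * M + 1) * (real (r choose i) * (\<rho>\<^sup>2) ^ i * beta_avg (M + i) (L + (r - i)))"
      unfolding sum_eq e(2) \<rho>_power e_def[symmetric] id[OF choose_pos] e(1)
      by (rule mult_1_left)
  qed
  then show ?thesis by (simp only: sum_distrib_left)
qed

text \<open>Bernoulli's inequality for x / y - 1, rescaled by y^r. Integrating this tangent bound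
  replaces an appeal to Jensen's inequality.\<close>

lemma power_tangent_le:
  fixes x y :: real
  assumes "x \<ge> 0" "y > 0"
  shows "y ^ r + real r * y ^ (r - 1) * (x - y) \<le> x ^ r"
proof (cases "r = 0")
  case False
  have "1 + real r * (x / y - 1) \<le> (1 + (x / y - 1)) ^ r"
    using assms by (intro Bernoulli_inequality) auto
  then have "y ^ r * (1 + real r * (x / y - 1)) \<le> y ^ r * (x / y) ^ r"
    using assms by (intro mult_left_mono) auto
  moreover have "y ^ r * (x / y) ^ r = x ^ r"
    using assms by (simp add: power_divide)
  moreover have "y ^ r * (1 + real r * (x / y - 1)) = y ^ r + real r * y ^ (r - 1) * (x - y)"
    using assms False by (cases r) (auto simp: field_simps)
  ultimately show ?thesis by simp
qed auto

text \<open>By the binomial theorem the right side is the average of \<sigma>^M (1 - \<sigma>)^L (1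
  - \<delta> \<sigma>)^r, where \<delta> = 1 - \<rho>^2. Since \<open>s\<close> is the mean of
  \<sigma> under the weight \<sigma>^M (1 - \<sigma>)^L, the linear term of the tangent at 1 -
  \<delta> s integrates to 0.\<close>

lemma sum_choose_beta_avg_ge:
  fixes M L :: nat
  assumes \<rho>: "0 < \<rho>" "\<rho> < 1"
  defines "s \<equiv> (real M + 1/2) / (real M + real L + 1)"
  shows "(1 - (1 - \<rho>\<^sup>2) * s) ^ r * beta_avg M L
     \<le> (\<Sum>i\<le>r. real (r choose i) * (\<rho>\<^sup>2) ^ i * beta_avg (M + i) (L + (r - i)))"
proof -
  define \<delta> where "\<delta> = 1 - \<rho>\<^sup>2"
  define y where "y = 1 - \<delta> * s"
  have "\<rho>\<^sup>2 < 1" using \<rho> by (simp add: power_less_one_iff)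
  then have \<delta>: "0 \<le> \<delta>" "\<delta> < 1" using \<rho> by (auto simp: \<delta>_def)
  have s: "0 \<le> s" "s \<le> 1" unfolding s_def by (auto simp: divide_simps)
  have "\<delta> * s \<le> \<delta> * 1" using \<delta> s by (intro mult_left_mono) auto
  then have y: "y > 0" using \<delta> unfolding y_def by linarith
  let ?w = "\<lambda>t::real. ((sin (t / 2))\<^sup>2) ^ M * ((cos (t / 2))\<^sup>2) ^ L"
  let ?w' = "\<lambda>t::real. ((sin (t / 2))\<^sup>2) ^ Suc M * ((cos (t / 2))\<^sup>2) ^ L"
  have upper: "((\<lambda>t. \<Sum>i\<le>r. real (r choose i) * (\<rho>\<^sup>2) ^ i * (((sin (t / 2))\<^sup>2) ^ (M + i) * ((cos (t / 2))\<^sup>2) ^ (L + (r - i))))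
     has_integral (\<Sum>i\<le>r. real (r choose i) * (\<rho>\<^sup>2) ^ i * (2 * pi * beta_avg (M + i) (L + (r - i))))) {0..2 * pi}"
    by (intro has_integral_sum has_integral_mult_right has_integral_beta_avg) auto
  have lower: "((\<lambda>t. (y ^ r + real r * y ^ (r - 1) * (1 - y)) * ?w t - real r * y ^ (r - 1) * \<delta> * ?w' t)
     has_integral ((y ^ r + real r * y ^ (r - 1) * (1 - y)) * (2 * pi * beta_avg M L)
        - real r * y ^ (r - 1) * \<delta> * (2 * pi * beta_avg (Suc M) L))) {0..2 * pi}"
    by (intro has_integral_diff has_integral_mult_right has_integral_beta_avg)
  have "(y ^ r + real r * y ^ (r - 1) * (1 - y)) * (2 * pi * beta_avg M L)
        - real r * y ^ (r - 1) * \<delta> * (2 * pi * beta_avg (Suc M) L)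
     \<le> (\<Sum>i\<le>r. real (r choose i) * (\<rho>\<^sup>2) ^ i * (2 * pi * beta_avg (M + i) (L + (r - i))))"
  proof (rule has_integral_le[OF lower upper])
    fix t :: real
    define \<sigma> where "\<sigma> = (sin (t / 2))\<^sup>2"
    have cos: "(cos (t / 2))\<^sup>2 = 1 - \<sigma>" by (simp add: \<sigma>_def cos_squared_eq)
    have \<sigma>: "0 \<le> \<sigma>" "\<sigma> \<le> 1" unfolding \<sigma>_def by (auto simp: abs_square_le_1)
    have "\<delta> * \<sigma> \<le> 1 * 1" using \<delta> \<sigma> by (intro mult_mono) auto
    then have "y ^ r + real r * y ^ (r - 1) * ((1 - \<delta> * \<sigma>) - y) \<le> (1 - \<delta> * \<sigma>) ^ r"
      using y by (intro power_tangent_le) auto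
    then have "?w t * (y ^ r + real r * y ^ (r - 1) * ((1 - \<delta> * \<sigma>) - y)) \<le> ?w t * (1 - \<delta> * \<sigma>) ^ r"
      by (intro mult_left_mono) auto
    also have "1 - \<delta> * \<sigma> = \<rho>\<^sup>2 * \<sigma> + (1 - \<sigma>)"
      by (simp add: \<delta>_def algebra_simps)
    also have "(\<rho>\<^sup>2 * \<sigma> + (1 - \<sigma>)) ^ r = (\<Sum>i\<le>r. real (r choose i) * (\<rho>\<^sup>2 * \<sigma>) ^ i * (1 - \<sigma>) ^ (r - i))"
      by (rule binomial_ring)
    also have "?w t * \<dots> = (\<Sum>i\<le>r. real (r choose i) * (\<rho>\<^sup>2) ^ i * (((sin (t / 2))\<^sup>2) ^ (M + i) * ((cos (t / 2))\<^sup>2) ^ (L + (r - i))))"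
      unfolding cos \<sigma>_def[symmetric] by (simp only: sum_distrib_left power_mult_distrib power_add mult_ac)
    also have "?w t * (y ^ r + real r * y ^ (r - 1) * (\<rho>\<^sup>2 * \<sigma> + (1 - \<sigma>) - y))
      = (y ^ r + real r * y ^ (r - 1) * (1 - y)) * ?w t - real r * y ^ (r - 1) * \<delta> * ?w' t"
      unfolding cos \<sigma>_def[symmetric] \<delta>_def by (simp add: algebra_simps)
    finally show "(y ^ r + real r * y ^ (r - 1) * (1 - y)) * ?w t - real r * y ^ (r - 1) * \<delta> * ?w' t
       \<le> (\<Sum>i\<le>r. real (r choose i) * (\<rho>\<^sup>2) ^ i * (((sin (t / 2))\<^sup>2) ^ (M + i) * ((cos (t / 2))\<^sup>2) ^ (L + (r - i))))" .
  qed
  moreover have "beta_avg (Suc M) L = s * beta_avg M L"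
    by (simp add: beta_avg_Suc_left s_def)
  ultimately have "2 * pi * (y ^ r * beta_avg M L)
     \<le> 2 * pi * (\<Sum>i\<le>r. real (r choose i) * (\<rho>\<^sup>2) ^ i * beta_avg (M + i) (L + (r - i)))"
    by (simp add: y_def sum_distrib_left algebra_simps)
  then show ?thesis
    by (simp add: y_def \<delta>_def)
qed

text \<open>Krawtchouk symmetry cancels the denominators and turns the sum over \<open>i\<close>
  into the binomial expansion of ((1 + y)^2 - (1 - y)^2)^r = (4 y)^r.\<close>

lemma test_fun_eq_coeff:
  assumes x: "x \<in> cube n" and n: "n = k + 2 * L + 2 * r"
  shows "real (n choose minuses n x) * test_fun n k r x
     = 4 ^ r * coeff ([:0, 1:] ^ r * [:1, -1:] ^ k * [:1, 1:] ^ (2 * L)) (minuses n x)"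
proof -
  let ?j = "minuses n x"
  let ?A = "[:1, 1:] :: real poly" and ?B = "[:1, -1:] :: real poly"
  have "real (n choose ?j) * test_fun n k r x
     = (\<Sum>i\<le>r. real (n choose ?j) * ((-1) ^ i * real (r choose i) / real (n choose (k + 2 * i))
         * (\<Sum>S | S \<subseteq> {1..n} \<and> card S = k + 2 * i. walsh S x)))"
    unfolding test_fun_def by (rule sum_distrib_left)
  also have "\<dots> = (\<Sum>i\<le>r. (-1) ^ i * real (r choose i) * krawtchouk n (k + 2 * i) ?j)"
  proof (intro sum.cong refl)
    fix i assume i: "i \<in> {..r}"
    have "real (n choose (k + 2 * i)) > 0" using i n by simp
    moreover have "(\<Sum>S | S \<subseteq> {1..n} \<and> card S = k + 2 * i. walsh S x) = krawtchouk n ?j (k + 2 * i)"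
      by (rule sum_walsh_card[OF x])
    ultimately show "real (n choose ?j) * ((-1) ^ i * real (r choose i) / real (n choose (k + 2 * i))
         * (\<Sum>S | S \<subseteq> {1..n} \<and> card S = k + 2 * i. walsh S x))
      = (-1) ^ i * real (r choose i) * krawtchouk n (k + 2 * i) ?j"
      using krawtchouk_symmetry[of n "k + 2 * i" ?j] by (simp add: field_simps)
  qed
  also have "\<dots> = coeff (\<Sum>i\<le>r. of_nat (r choose i) * (- ?B\<^sup>2) ^ i * (?A\<^sup>2) ^ (r - i) * (?B ^ k * ?A ^ (2 * L))) ?j"
    unfolding coeff_sum
  proof (intro sum.cong refl)
    fix i assume i: "i \<in> {..r}"
    have e: "n - (k + 2 * i) = 2 * (r - i) + 2 * L" using i n by simp
    have "of_nat (r choose i) * (- ?B\<^sup>2) ^ i * (?A\<^sup>2) ^ (r - i) * (?B ^ k * ?A ^ (2 * L))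
      = smult ((-1) ^ i * real (r choose i)) (?B ^ (k + 2 * i) * ?A ^ (n - (k + 2 * i)))"
    proof -
      have "(- ?B\<^sup>2) ^ i = smult ((-1) ^ i) (?B ^ (2 * i))"
        by (cases "even i") (auto simp: power_mult)
      then show ?thesis
        unfolding e by (simp add: power_add of_nat_poly power_mult [symmetric] mult_ac)
    qed
    then show "(-1) ^ i * real (r choose i) * krawtchouk n (k + 2 * i) ?j
       = coeff (of_nat (r choose i) * (- ?B\<^sup>2) ^ i * (?A\<^sup>2) ^ (r - i) * (?B ^ k * ?A ^ (2 * L))) ?j"
      by (simp only: coeff_smult krawtchouk_def)
  qed
  also have "(\<Sum>i\<le>r. of_nat (r choose i) * (- ?B\<^sup>2) ^ i * (?A\<^sup>2) ^ (r - i) * (?B ^ k * ?A ^ (2 * L)))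
     = (- ?B\<^sup>2 + ?A\<^sup>2) ^ r * (?B ^ k * ?A ^ (2 * L))"
    by (simp only: binomial_ring sum_distrib_right)
  also have "- ?B\<^sup>2 + ?A\<^sup>2 = smult 4 [:0, 1:]"
    by (simp add: power2_eq_square)
  also have "smult 4 [:0, 1:] ^ r = smult (4 ^ r) ([:0, 1:] ^ r)"
    by (rule smult_power)
  finally show ?thesis
    by (simp only: mult_smult_left coeff_smult mult.assoc)
qed

section \<open>Uniform bound on the test function\<close>


lemma cmod_one_minus_cis: "(cmod (1 - of_real R * cis t))\<^sup>2 = (1 - R)\<^sup>2 + 4 * R * (sin (t / 2))\<^sup>2"
proof -
  have "(cmod (1 - of_real R * cis t))\<^sup>2 = (1 - R * cos t)\<^sup>2 + (R * sin t)\<^sup>2"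
    by (simp add: cmod_power2)
  also have "\<dots> = 1 - 2 * R * cos t + R\<^sup>2 * ((sin t)\<^sup>2 + (cos t)\<^sup>2)"
    by algebra
  also have "(sin t)\<^sup>2 + (cos t)\<^sup>2 = 1" by simp
  also have "cos t = 1 - 2 * (sin (t / 2))\<^sup>2"
    using cos_double_sin[of "t / 2"] by simp
  finally show ?thesis
    by (simp add: power2_eq_square algebra_simps)
qed

lemma cmod_one_plus_cis: "(cmod (1 + of_real R * cis t))\<^sup>2 = (1 - R)\<^sup>2 + 4 * R * (cos (t / 2))\<^sup>2"
proof -
  have "(cmod (1 + of_real R * cis t))\<^sup>2 = (1 + R * cos t)\<^sup>2 + (R * sin t)\<^sup>2"
    by (simp add: cmod_power2)
  also have "\<dots> = 1 + 2 * R * cos t + R\<^sup>2 * ((sin t)\<^sup>2 + (cos t)\<^sup>2)"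
    by algebra
  also have "(sin t)\<^sup>2 + (cos t)\<^sup>2 = 1" by simp
  also have "cos t = 2 * (cos (t / 2))\<^sup>2 - 1"
    using cos_double_cos[of "t / 2"] by simp
  finally show ?thesis
    by (simp add: power2_eq_square algebra_simps)
qed

lemma tilted_avg_has_integral:
  "((\<lambda>t. (p + (1 - p) * (sin (t / 2))\<^sup>2) ^ a * (p + (1 - p) * (cos (t / 2))\<^sup>2) ^ b) has_integral
     2 * pi * tilted_avg p a b) {0..2 * pi}"
proof -
  have "(\<lambda>t. (p + (1 - p) * (sin (t / 2))\<^sup>2) ^ a * (p + (1 - p) * (cos (t / 2))\<^sup>2) ^ b) integrable_on {0..2 * pi}"
    by (intro integrable_continuous_interval continuous_intros) auto
  then show ?thesis
    by (simp add: tilted_avg_def integrable_integral)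
qed

text \<open>Cauchy's estimate on the circle of radius \<open>R\<close>. The odd exponent 2 M + 1
  leaves one unsquared factor u = |1 - z| / (1 + R), which u \<le> u^2 / (2 l) + l / 2 replaces by
  even powers; the weight \<open>l\<close> stays free.\<close>

lemma coeff_bound_tilted_avg:
  fixes R l :: real
  assumes R: "R > 0" and l: "l > 0"
  defines "p \<equiv> ((1 - R) / (1 + R))\<^sup>2"
  shows "\<bar>coeff ([:0, 1:] ^ r * [:1, -1:] ^ (2 * M + 1) * [:1, 1:] ^ (2 * L)) j\<bar> * R ^ j
    \<le> (1 + R) ^ (2 * (M + L + r) + 1) * ((1 - p) / 4) ^ r
        * (tilted_avg p (Suc M) L / (2 * l) + l * tilted_avg p M L / 2)"
proof -
  define h :: "real poly" where "h = [:0, 1:] ^ r * [:1, -1:] ^ (2 * M + 1) * [:1, 1:] ^ (2 * L)"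
  define H :: "complex poly" where "H = map_poly of_real h"
  have H: "poly H z = z ^ r * (1 - z) ^ (2 * M + 1) * (1 + z) ^ (2 * L)" for z
    by (simp add: H_def h_def map_poly_of_real_mult map_poly_of_real_power map_poly_pCons
        del: power_Suc mult_pCons_left mult_pCons_right)
  have R1: "1 + R > 0" using R by simp
  have p: "(1 + R)\<^sup>2 * p = (1 - R)\<^sup>2"
    using R1 by (simp add: p_def power_divide)
  then have q: "(1 + R)\<^sup>2 * (1 - p) = 4 * R"
    by (simp add: power2_eq_square algebra_simps)
  have sq: "(1 - R)\<^sup>2 + 4 * R * s = (1 + R)\<^sup>2 * (p + (1 - p) * s)" for s
    using p q by (simp add: distrib_left mult.assoc [symmetric])
  let ?X = "\<lambda>t::real. p + (1 - p) * (sin (t / 2))\<^sup>2"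
  let ?Y = "\<lambda>t::real. p + (1 - p) * (cos (t / 2))\<^sup>2"
  define C where "C = R ^ r * (1 + R) ^ (2 * M + 1 + 2 * L)"
  have C: "C \<ge> 0" unfolding C_def using R by simp
  have circle: "((\<lambda>t. poly H (of_real R * cis t) * cis (- (real j * t))) has_integral (2 * pi * coeff H j * R ^ j)) {0..2 * pi}"
    by (rule poly_coeff_circle)
  have maj: "((\<lambda>t. C * (?X t ^ Suc M * ?Y t ^ L / (2 * l) + l / 2 * (?X t ^ M * ?Y t ^ L))) has_integral
     C * (2 * pi * tilted_avg p (Suc M) L / (2 * l) + l / 2 * (2 * pi * tilted_avg p M L))) {0..2 * pi}"
    by (intro has_integral_mult_right has_integral_add has_integral_divide tilted_avg_has_integral)
  have "cmod (2 * pi * coeff H j * R ^ j) \<le> C * (2 * pi * tilted_avg p (Suc M) L / (2 * l) + l / 2 * (2 * pi * tilted_avg p M L))"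
    unfolding integral_unique[OF circle, symmetric] integral_unique[OF maj, symmetric]
  proof (rule integral_norm_bound_integral)
    show "(\<lambda>t. poly H (of_real R * cis t) * cis (- (real j * t))) integrable_on {0..2 * pi}"
      using circle by blast
    show "(\<lambda>t. C * (?X t ^ Suc M * ?Y t ^ L / (2 * l) + l / 2 * (?X t ^ M * ?Y t ^ L))) integrable_on {0..2 * pi}"
      using maj by blast
    fix t :: real
    define u where "u = cmod (1 - of_real R * cis t) / (1 + R)"
    define v where "v = cmod (1 + of_real R * cis t) / (1 + R)"
    have u: "u \<ge> 0" "u\<^sup>2 = ?X t" and v: "v\<^sup>2 = ?Y t"
      using R1 by (simp_all add: u_def v_def power_divide cmod_one_minus_cis cmod_one_plus_cis sq)
    have "0 \<le> (u - l)\<^sup>2" by simp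
    then have ul: "u \<le> u\<^sup>2 / (2 * l) + l / 2"
      using l by (simp add: power2_eq_square field_simps)
    have "cmod (poly H (of_real R * cis t) * cis (- (real j * t)))
       = R ^ r * ((1 + R) * u) ^ (2 * M + 1) * ((1 + R) * v) ^ (2 * L)"
      unfolding H using R R1 by (simp add: norm_mult norm_power u_def v_def del: power_Suc)
    also have "\<dots> = C * ((u\<^sup>2) ^ M * (v\<^sup>2) ^ L * u)"
      unfolding C_def by (simp only: power_mult_distrib power_add power_mult power_one_right) (simp only: mult_ac)
    also have "\<dots> \<le> C * ((u\<^sup>2) ^ M * (v\<^sup>2) ^ L * (u\<^sup>2 / (2 * l) + l / 2))"
      using C ul by (intro mult_left_mono) auto
    also have "\<dots> = C * (?X t ^ Suc M * ?Y t ^ L / (2 * l) + l / 2 * (?X t ^ M * ?Y t ^ L))"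
      unfolding u v by (simp add: distrib_left mult_ac)
    finally show "cmod (poly H (of_real R * cis t) * cis (- (real j * t)))
       \<le> C * (?X t ^ Suc M * ?Y t ^ L / (2 * l) + l / 2 * (?X t ^ M * ?Y t ^ L))" .
  qed
  also have "cmod (2 * pi * coeff H j * R ^ j) = 2 * pi * (\<bar>coeff h j\<bar> * R ^ j)"
    using R by (simp add: H_def coeff_map_poly norm_mult norm_power)
  also have "C * (2 * pi * tilted_avg p (Suc M) L / (2 * l) + l / 2 * (2 * pi * tilted_avg p M L))
     = 2 * pi * (C * (tilted_avg p (Suc M) L / (2 * l) + l * tilted_avg p M L / 2))"
    by (simp add: algebra_simps)
  finally have "\<bar>coeff h j\<bar> * R ^ j \<le> C * (tilted_avg p (Suc M) L / (2 * l) + l * tilted_avg p M L / 2)"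
    by simp
  \<comment> \<open>The identity R = (1 + R)^2 (1 - p) / 4 turns R^r into the damping factor that
    \<open>tilted_avg_le\<close> expects.\<close>
  also have "C = (1 + R) ^ (2 * (M + L + r) + 1) * ((1 - p) / 4) ^ r"
  proof -
    have "R ^ r = ((1 - p) / 4) ^ r * (1 + R) ^ (2 * r)"
      by (simp only: power_mult power_mult_distrib [symmetric]) (use q in \<open>simp add: mult_ac\<close>)
    moreover have "2 * (M + L + r) + 1 = 2 * r + (2 * M + 1 + 2 * L)" by simp
    ultimately show ?thesis unfolding C_def by (simp only: power_add mult_ac)
  qed
  finally show ?thesis by (simp only: h_def)
qed

text \<open>For 0 < j < n the radius R = j / (n - j) makes (1 + R)^n / R^j equal to n^n / (j^j (n -
  j)^(n - j)), which \<open>binomial_ge_entropy\<close> compares with n choose j.\<close>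

lemma test_fun_bound:
  assumes M: "M \<ge> 1" and L: "L \<ge> 1" and n: "n = 2 * (M + L + r) + 1" and x: "x \<in> cube n"
    and r: "real r \<ge> real (M + 1 + L) * (1 + 1 / sqrt (real M) + 1 / sqrt (real L))"
  defines "s \<equiv> (real M + 1/2) / (real M + real L + 1)"
  shows "\<bar>test_fun n (2 * M + 1) r x\<bar> \<le> 32 * sqrt (real n * s) * beta_avg M L"
proof -
  define j where "j = minuses n x"
  define h :: "real poly" where "h = [:0, 1:] ^ r * [:1, -1:] ^ (2 * M + 1) * [:1, 1:] ^ (2 * L)"
  have j: "j \<le> n" by (simp add: j_def minuses_le)
  have s: "s > 0" by (auto simp: s_def divide_simps)
  have "0 < real (M + 1 + L) * 1" by simp
  also have "\<dots> \<le> real (M + 1 + L) * (1 + 1 / sqrt (real M) + 1 / sqrt (real L))"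
    by (intro mult_left_mono) auto
  also note r
  finally have r1: "r \<ge> 1" by simp
  have eq: "real (n choose j) * test_fun n (2 * M + 1) r x = 4 ^ r * coeff h j"
    unfolding j_def h_def by (rule test_fun_eq_coeff[OF x]) (use n in simp)
  have bound_nonneg: "32 * sqrt (real n * s) * beta_avg M L \<ge> 0"
    using s less_imp_le[OF beta_avg_pos] by simp
  have choose_pos: "real (n choose j) > 0" using j by simp
  show ?thesis
  proof (cases "1 \<le> j \<and> j < n")
    \<comment> \<open>At the extreme levels the value is 0: the factor y^r kills the constant
      coefficient, and the degree is at most n - r < n.\<close>
    case False
    then consider "j = 0" | "j = n" using j by linarith
    then have "coeff h j = 0"
    proof cases
      case 1
      then show ?thesis using r1 by (simp add: h_def coeff_mult_0 coeff_0_power)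
    next
      case 2
      have "degree h \<le> r + (2 * M + 1) + 2 * L"
        unfolding h_def
        by (intro order.trans[OF degree_mult_le] add_mono order.trans[OF degree_power_le]) auto
      also have "\<dots> < j" using 2 n r1 by simp
      finally show ?thesis by (rule coeff_eq_0)
    qed
    with eq choose_pos have "test_fun n (2 * M + 1) r x = 0" by simp
    then show ?thesis using bound_nonneg by simp
  next
    case True
    define R where "R = real j / real (n - j)"
    define p where "p = ((1 - R) / (1 + R))\<^sup>2"
    define k where "k = n - j"
    have k: "k \<ge> 1" "n = j + k" using True by (auto simp: k_def)
    have R: "R > 0" using True by (simp add: R_def)
    have "(1 - R)\<^sup>2 \<le> (1 + R)\<^sup>2"
      using R by (simp add: power2_eq_square algebra_simps)
    then have p: "0 \<le> p" "p \<le> 1"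
      using R by (auto simp: p_def power_divide)
    have tilt1: "(1 - p) ^ r * tilted_avg p M L \<le> 16 * beta_avg M L"
    proof (rule tilted_avg_le[OF p])
      have "real (M + L) * (1 + 1 / sqrt (real M) + 1 / sqrt (real L))
         \<le> real (M + 1 + L) * (1 + 1 / sqrt (real M) + 1 / sqrt (real L))"
        by (intro mult_right_mono) auto
      then show "real (M + L) * (1 + 1 / sqrt (real M) + 1 / sqrt (real L)) \<le> real r" using r by linarith
    qed
    \<comment> \<open>The case \<open>Suc M\<close> is why the hypothesis on \<open>r\<close> has M
      + 1 + L. Raising the exponent by one gains the factor \<open>s\<close>.\<close>
    have tilt2: "(1 - p) ^ r * tilted_avg p (Suc M) L \<le> 16 * (s * beta_avg M L)"
    proof -
      have "1 / sqrt (real (Suc M)) \<le> 1 / sqrt (real M)"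
        using M by (intro divide_left_mono) auto
      then have "real (Suc M + L) * (1 + 1 / sqrt (real (Suc M)) + 1 / sqrt (real L))
         \<le> real (M + 1 + L) * (1 + 1 / sqrt (real M) + 1 / sqrt (real L))"
        by (intro mult_mono) auto
      then have "(1 - p) ^ r * tilted_avg p (Suc M) L \<le> 16 * beta_avg (Suc M) L"
        using r by (intro tilted_avg_le[OF p]) linarith
      then show ?thesis by (simp add: beta_avg_Suc_left s_def)
    qed
    \<comment> \<open>This weight equalises the two summands, each becoming 8
      \<open>l * beta_avg M L\<close>.\<close>
    define l where "l = sqrt s"
    have l: "l > 0" "s = l * l" using s by (auto simp: l_def)
    have "(1 - p) ^ r * (tilted_avg p (Suc M) L / (2 * l) + l * tilted_avg p M L / 2)
       = ((1 - p) ^ r * tilted_avg p (Suc M) L) / (2 * l) + l / 2 * ((1 - p) ^ r * tilted_avg p M L)"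
      by (simp add: algebra_simps)
    also have "\<dots> \<le> 16 * (s * beta_avg M L) / (2 * l) + l / 2 * (16 * beta_avg M L)"
      using l tilt1 tilt2 by (intro add_mono divide_right_mono mult_left_mono) auto
    also have "\<dots> = 16 * l * beta_avg M L"
      using l by (simp add: l(2))
    finally have tilt: "(1 - p) ^ r * (tilted_avg p (Suc M) L / (2 * l) + l * tilted_avg p M L / 2) \<le> 16 * l * beta_avg M L" .
    have "4 ^ r * \<bar>coeff h j\<bar> * R ^ j
      \<le> 4 ^ r * ((1 + R) ^ n * ((1 - p) / 4) ^ r * (tilted_avg p (Suc M) L / (2 * l) + l * tilted_avg p M L / 2))"
      unfolding mult.assoc using coeff_bound_tilted_avg[OF R l(1), of r M L j]
      by (intro mult_left_mono) (simp_all add: h_def p_def n mult.assoc)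
    also have "\<dots> = (1 + R) ^ n * ((1 - p) ^ r * (tilted_avg p (Suc M) L / (2 * l) + l * tilted_avg p M L / 2))"
      by (simp add: power_divide)
    also have "\<dots> \<le> (1 + R) ^ n * (16 * l * beta_avg M L)"
      using R by (intro mult_left_mono tilt) auto
    finally have main: "4 ^ r * \<bar>coeff h j\<bar> * R ^ j \<le> (1 + R) ^ n * (16 * l * beta_avg M L)" .
    have "1 + R = real n / real k" using k True by (simp add: R_def k_def[symmetric] divide_simps)
    then have "(1 + R) ^ n = real n ^ n / real k ^ n" by (simp add: power_divide)
    also have "\<dots> \<le> 2 * sqrt (real n) * real (n choose j) * real j ^ j * real k ^ k / real k ^ n"
      using binomial_ge_entropy[of j n] True by (intro divide_right_mono) (auto simp: k_def)
    also have "\<dots> = 2 * sqrt (real n) * real (n choose j) * R ^ j"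
      using k True by (simp add: R_def k_def[symmetric] power_divide k(2) power_add)
    finally have "(1 + R) ^ n \<le> 2 * sqrt (real n) * real (n choose j) * R ^ j" .
    then have "(1 + R) ^ n * (16 * l * beta_avg M L) \<le> 2 * sqrt (real n) * real (n choose j) * R ^ j * (16 * l * beta_avg M L)"
      using l less_imp_le[OF beta_avg_pos, of M L] by (intro mult_right_mono) auto
    with main have "R ^ j * (4 ^ r * \<bar>coeff h j\<bar>) \<le> R ^ j * (real (n choose j) * (32 * (sqrt (real n) * l) * beta_avg M L))"
      by (simp add: mult_ac)
    then have "4 ^ r * \<bar>coeff h j\<bar> \<le> real (n choose j) * (32 * (sqrt (real n) * l) * beta_avg M L)"
      using R by (subst (asm) mult_le_cancel_left_pos) auto
    moreover have "4 ^ r * \<bar>coeff h j\<bar> = real (n choose j) * \<bar>test_fun n (2 * M + 1) r x\<bar>"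
      using arg_cong[OF eq, of abs] by (simp add: abs_mult)
    ultimately have "\<bar>test_fun n (2 * M + 1) r x\<bar> \<le> 32 * (sqrt (real n) * l) * beta_avg M L"
      using choose_pos by (simp only: mult_le_cancel_left_pos)
    then show ?thesis
      by (simp add: l_def real_sqrt_mult)
  qed
qed


text \<open>Duality: pairing with the test function removes \<open>p\<close> by orthogonality, and
  the pairing is at most the uniform bound times the L1 norm. The factor \<open>beta_avg M L\<close>
  occurs in both estimates and cancels.\<close>

lemma L1_norm_noise_Maj_ge:
  assumes \<rho>: "0 < \<rho>" "\<rho> < 1" and M: "M \<ge> 1" and L: "L \<ge> 1" and n: "n = 2 * (M + L + r) + 1"
    and r: "real r \<ge> real (M + 1 + L) * (1 + 1 / sqrt (real M) + 1 / sqrt (real L))"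
    and p: "p \<in> multilinear_polys n m" and m: "m \<le> 2 * M"
  defines "s \<equiv> (real M + 1/2) / (real M + real L + 1)"
  shows "L1_norm n (\<lambda>x. noise_op n \<rho> (Maj n) x - p x)
     \<ge> \<rho> ^ (2 * M + 1) * (1 - (1 - \<rho>\<^sup>2) * s) ^ r / (32 * sqrt (real n * s))"
proof -
  define g where "g = test_fun n (2 * M + 1) r"
  define D where "D = (\<lambda>x. noise_op n \<rho> (Maj n) x - p x)"
  define W where "W = beta_avg M L"
  define B where "B = (\<Sum>i\<le>r. real (r choose i) * (\<rho>\<^sup>2) ^ i * beta_avg (M + i) (L + (r - i)))"
  have W: "W > 0" by (simp add: W_def beta_avg_pos)
  have "s > 0" by (auto simp: s_def divide_simps)
  moreover have "n > 0" using n by simp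
  ultimately have ns: "sqrt (real n * s) > 0" by simp
  have B: "(1 - (1 - \<rho>\<^sup>2) * s) ^ r * W \<le> B"
    unfolding B_def W_def s_def by (rule sum_choose_beta_avg_ge[OF \<rho>])
  have B0: "0 \<le> B"
    unfolding B_def using \<rho> less_imp_le[OF beta_avg_pos]
    by (intro sum_nonneg mult_nonneg_nonneg) auto
  have "(\<Sum>x\<in>cube n. g x * D x) = (\<Sum>x\<in>cube n. g x * noise_op n \<rho> (Maj n) x) - (\<Sum>x\<in>cube n. g x * p x)"
    by (simp add: D_def right_diff_distrib sum_subtractf)
  also have "(\<Sum>x\<in>cube n. g x * p x) = 0"
    unfolding g_def using m by (intro sum_test_fun_poly[OF p]) simp
  also have "(\<Sum>x\<in>cube n. g x * noise_op n \<rho> (Maj n) x) = 2 ^ n * (-1) ^ M * \<rho> ^ (2 * M + 1) * B"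
    unfolding g_def B_def by (rule sum_test_fun_noise_Maj[OF \<rho> n])
  finally have "2 ^ n * \<rho> ^ (2 * M + 1) * B = \<bar>\<Sum>x\<in>cube n. g x * D x\<bar>"
    using \<rho> B0 by (simp add: abs_mult power_abs)
  also have "\<dots> \<le> (\<Sum>x\<in>cube n. \<bar>g x * D x\<bar>)"
    by (rule sum_abs)
  also have "\<dots> \<le> (\<Sum>x\<in>cube n. 32 * sqrt (real n * s) * W * \<bar>D x\<bar>)"
    unfolding abs_mult g_def W_def s_def
    by (intro sum_mono mult_right_mono test_fun_bound[OF M L n _ r]) auto
  also have "\<dots> = 32 * sqrt (real n * s) * W * (\<Sum>x\<in>cube n. \<bar>D x\<bar>)"
    by (simp add: sum_distrib_left)
  also have "(\<Sum>x\<in>cube n. \<bar>D x\<bar>) = 2 ^ n * L1_norm n D"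
    by (simp add: L1_norm_eq_sum)
  finally have "2 ^ n * (\<rho> ^ (2 * M + 1) * B) \<le> 2 ^ n * (32 * sqrt (real n * s) * W * L1_norm n D)"
    by (simp add: mult_ac)
  then have "\<rho> ^ (2 * M + 1) * B \<le> 32 * sqrt (real n * s) * W * L1_norm n D"
    by (subst (asm) mult_le_cancel_left_pos) auto
  moreover have "\<rho> ^ (2 * M + 1) * ((1 - (1 - \<rho>\<^sup>2) * s) ^ r * W) \<le> \<rho> ^ (2 * M + 1) * B"
    using \<rho> by (intro mult_left_mono B) auto
  ultimately have "W * (\<rho> ^ (2 * M + 1) * (1 - (1 - \<rho>\<^sup>2) * s) ^ r) \<le> W * (L1_norm n D * (32 * sqrt (real n * s)))"
    by (simp add: mult_ac)
  then have "\<rho> ^ (2 * M + 1) * (1 - (1 - \<rho>\<^sup>2) * s) ^ r \<le> L1_norm n D * (32 * sqrt (real n * s))"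
    using W by (subst (asm) mult_le_cancel_left_pos) auto
  then show ?thesis
    using ns by (simp add: pos_divide_le_eq D_def)
qed

section \<open>Choice of parameters\<close>


lemma ln_one_minus_le:
  assumes "0 \<le> x" "x < (1::real)"
  shows "ln (1 - x) \<le> - x - x\<^sup>2 / 2"
proof -
  let ?f = "\<lambda>x::real. - x - x\<^sup>2 / 2 - ln (1 - x)"
  have "?f 0 \<le> ?f x"
  proof (rule DERIV_nonneg_imp_nondecreasing[OF assms(1)])
    fix y :: real assume y: "0 \<le> y" "y \<le> x"
    have "(?f has_real_derivative - 1 - y + 1 / (1 - y)) (at y)"
      using y assms by (auto intro!: derivative_eq_intros)
    moreover have "- 1 - y + 1 / (1 - y) = y\<^sup>2 / (1 - y)"
      using y assms by (simp add: field_simps power2_eq_square)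
    moreover have "y\<^sup>2 / (1 - y) \<ge> 0"
      using y assms by simp
    ultimately show "\<exists>z. (?f has_real_derivative z) (at y) \<and> 0 \<le> z" by metis
  qed
  then show ?thesis by simp
qed

text \<open>Logarithms are compared. The second-order term of ln (1 - \<delta>) supplies about M
  \<delta>^2 / 2, which absorbs the excess 2 \<delta> sqrt M, so the loss is bounded uniformly in
  \<rho> and M.\<close>

lemma damping_ge:
  fixes \<rho> s :: real
  assumes \<rho>: "0 < \<rho>" "\<rho> < 1" and M: "M \<ge> 1" and s: "0 \<le> s" "s \<le> 1/2"
    and rs: "real r * s \<le> real M + 2 * sqrt (real M) + 2" and rss: "real r * s * s \<le> 1/2"
  shows "exp (-7) * (\<rho>\<^sup>2) ^ (M - 1) \<le> (1 - (1 - \<rho>\<^sup>2) * s) ^ r"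
proof -
  define \<delta> where "\<delta> = 1 - \<rho>\<^sup>2"
  have "\<rho>\<^sup>2 < 1" using \<rho> by (simp add: power_less_one_iff)
  then have \<delta>: "0 \<le> \<delta>" "\<delta> < 1" "\<rho>\<^sup>2 = 1 - \<delta>" using \<rho> by (auto simp: \<delta>_def)
  have "\<delta> * s \<le> 1 * s" using \<delta> s by (intro mult_right_mono) auto
  then have ds: "0 \<le> \<delta> * s" "\<delta> * s \<le> 1/2" using \<delta> s by auto
  have "\<delta>\<^sup>2 \<le> 1" using \<delta> by (simp add: abs_square_le_1)
  then have "\<delta>\<^sup>2 * (2 * (real r * s * s)) \<le> 1 * (2 * (1/2))"
    using s rss by (intro mult_mono) auto
  moreover have "\<delta> * (real r * s) \<le> \<delta> * (real M + 2 * sqrt (real M) + 2)"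
    using \<delta> rs by (intro mult_left_mono) auto
  moreover have "real r * (- (\<delta> * s) - 2 * (\<delta> * s)\<^sup>2) \<le> real r * ln (1 - \<delta> * s)"
    using ds by (intro mult_left_mono ln_one_minus_pos_lower_bound) auto
  ultimately have lower: "- \<delta> * (real M + 2 * sqrt (real M) + 2) - 1 \<le> real r * ln (1 - \<delta> * s)"
    by (simp add: power2_eq_square algebra_simps)
  have upper: "real (M - 1) * ln (1 - \<delta>) \<le> (real M - 1) * (- \<delta> - \<delta>\<^sup>2 / 2)"
    using M mult_left_mono[OF ln_one_minus_le[OF \<delta>(1,2)], of "real (M - 1)"] by simp
  \<comment> \<open>This gives 2 \<delta> sqrt M \<le> M \<delta>^2 / 2 + 2. The remaining errors
    are at most 1 + 3 \<delta> + \<delta>^2 / 2, so 7 is enough.\<close>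
  have "0 \<le> (sqrt (real M) * \<delta> - 2)\<^sup>2" by simp
  also have "\<dots> = (sqrt (real M))\<^sup>2 * \<delta>\<^sup>2 - 4 * (sqrt (real M) * \<delta>) + 4"
    by (simp add: power2_eq_square algebra_simps)
  finally have "0 \<le> real M * \<delta>\<^sup>2 - 4 * (sqrt (real M) * \<delta>) + 4" by simp
  then have "-7 + (real M - 1) * (- \<delta> - \<delta>\<^sup>2 / 2) \<le> - \<delta> * (real M + 2 * sqrt (real M) + 2) - 1"
    using \<open>\<delta>\<^sup>2 \<le> 1\<close> \<delta>(1,2) by (simp add: algebra_simps diff_divide_distrib)
  with lower upper have "-7 + real (M - 1) * ln (1 - \<delta>) \<le> real r * ln (1 - \<delta> * s)"
    by linarith
  then have "exp (-7 + real (M - 1) * ln (1 - \<delta>)) \<le> exp (real r * ln (1 - \<delta> * s))"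
    by simp
  moreover have "exp (-7 + real (M - 1) * ln (1 - \<delta>)) = exp (-7) * (1 - \<delta>) ^ (M - 1)"
    unfolding exp_add exp_of_nat_mult using \<delta>(2) by simp
  moreover have "exp (real r * ln (1 - \<delta> * s)) = (1 - \<delta> * s) ^ r"
    unfolding exp_of_nat_mult using ds by simp
  ultimately have "exp (-7) * (1 - \<delta>) ^ (M - 1) \<le> (1 - \<delta> * s) ^ r"
    by (simp only:)
  then show ?thesis
    unfolding \<delta>_def [symmetric] by (simp only: \<delta>(3))
qed

text \<open>The choice of parameters: the slack \<open>2 / sqrt M\<close> makes \<open>r\<close> large enough for the bound on
  the test function, while \<open>r * s\<close> exceeds \<open>M\<close> only by \<open>O(sqrt M)\<close>.\<close>

lemma exists_parameters:
  assumes M: "M \<ge> 1" and n: "n = 2 * N + 1" and Mn: "10000 * (real M)\<^sup>2 \<le> real n"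
  obtains L r where "L \<ge> 1" "N = M + L + r"
    "real r \<ge> real (M + 1 + L) * (1 + 1 / sqrt (real M) + 1 / sqrt (real L))"
    "real M + real L + 1 \<ge> real n / 16"
    "real r \<le> (real M + real L + 1) * (1 + 2 / sqrt (real M)) + 5"
proof -
  define \<beta> where "\<beta> = 2 + 2 / sqrt (real M)"
  have sqM: "sqrt (real M) \<ge> 1" using M by simp
  then have "2 / sqrt (real M) \<le> 2 / 1" by (intro divide_left_mono) auto
  then have \<beta>: "2 \<le> \<beta>" "\<beta> \<le> 4" using sqM by (auto simp: \<beta>_def)
  have M2: "1 \<le> (real M)\<^sup>2" "real M \<le> (real M)\<^sup>2"
    using M by (auto intro: one_le_power self_le_power)
  then have n_large: "real n \<ge> 10000" using Mn by linarith
  \<comment> \<open>\<open>K\<close> will be M + L + 1, the denominator of the mean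
    \<open>s\<close>. Then r = N - K + 1 is close to (\<beta> - 1) K = K (1 + 2 / sqrt M).\<close>
  define K where "K = nat \<lfloor>real N / \<beta>\<rfloor>"
  have "real N / \<beta> \<ge> 0" using \<beta> by simp
  then have K: "real K \<le> real N / \<beta>" "real N / \<beta> < real K + 1"
    unfolding K_def by linarith+
  have "real N / 4 \<le> real N / \<beta>" using \<beta> by (intro divide_left_mono) auto
  then have K_large: "real K \<ge> real n / 16" using K n n_large by simp
  define L where "L = K - 1 - M"
  define r where "r = N - (K - 1)"
  have "real K \<ge> 625 * (real M)\<^sup>2" using K_large Mn by linarith
  then have "real K \<ge> 2 * real M + 1" using M2 by linarith
  then have KM: "K \<ge> 2 * M + 1" by linarith
  then have L: "L \<ge> M" "M + L + 1 = K" unfolding L_def by auto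
  have "real K * 2 \<le> real K * \<beta>" using \<beta> by (intro mult_left_mono) auto
  moreover have KN: "real K * \<beta> \<le> real N" "real N < (real K + 1) * \<beta>"
    using K \<beta> by (simp_all add: field_simps)
  ultimately have "real K \<le> real N" by linarith
  then have r: "N = M + L + r" "real r = real N - real K + 1"
    using L KM unfolding r_def by auto
  \<comment> \<open>As L \<ge> M, the slack 2 / sqrt M covers both reciprocal square roots.\<close>
  have "1 / sqrt (real L) \<le> 1 / sqrt (real M)"
    using L M by (intro divide_left_mono) auto
  then have "real K * (1 + 1 / sqrt (real M) + 1 / sqrt (real L)) \<le> real K * (\<beta> - 1)"
    unfolding \<beta>_def by (intro mult_left_mono) auto
  also have "\<dots> \<le> real r"
    using KN(1) r(2) by (simp add: algebra_simps)
  finally have r_ge: "real r \<ge> real K * (1 + 1 / sqrt (real M) + 1 / sqrt (real L))" .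
  \<comment> \<open>Rounding costs \<beta> + 1 \<le> 5.\<close>
  have "real r \<le> real K * (\<beta> - 1) + 5"
    using KN(2) r(2) \<beta> by (simp add: algebra_simps)
  then have r_le: "real r \<le> real K * (1 + 2 / sqrt (real M)) + 5"
    by (simp add: \<beta>_def)
  have K_eq: "real M + real L + 1 = real K" "real (M + 1 + L) = real K"
    using L(2) by (simp_all flip: L(2))
  show ?thesis
    using that[of L r] L M r(1) r_ge r_le K_large unfolding K_eq by simp
qed

theorem lemmaB3:
  fixes c \<eta> :: real
  assumes "c > 0" and "0 < \<eta>" and "\<eta> < 1/2"
  shows "\<exists>(n\<^sub>0 :: nat) (K :: real). K > 0 \<and>
    (\<forall>(\<rho> :: real) (n :: nat) (m :: nat).
      0 < \<rho> \<longrightarrow> \<rho> < 1 \<longrightarrow> odd n \<longrightarrow> n \<ge> n\<^sub>0 \<longrightarrow> 1 \<le> m \<longrightarrow>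
      real m \<le> c * real n powr (1/2 - \<eta>) \<longrightarrow>
      (INF p \<in> multilinear_polys n m. L1_norm n (\<lambda>x. noise_op n \<rho> (Maj n) x - p x))
        \<ge> K * (\<rho> ^ (2 * m + 1) / sqrt (real m)))"
proof -
  \<comment> \<open>The threshold ensures 100 c \<le> n^\<eta>, hence 100 m \<le> sqrt n.\<close>
  define n\<^sub>0 where "n\<^sub>0 = nat \<lceil>(100 * c) powr (1 / \<eta>)\<rceil> + 1"
  \<comment> \<open>The constant is absolute: exp (-7) is the loss in \<open>damping_ge\<close>, and
    160 = 32 * 5 comes from the uniform bound with sqrt (n s) \<le> 5 sqrt m. Only
    \<open>n\<^sub>0\<close> depends on c and \<eta>.\<close>
  have main: "L1_norm n (\<lambda>x. noise_op n \<rho> (Maj n) x - p x) \<ge> exp (-7) / 160 * (\<rho> ^ (2 * m + 1) / sqrt (real m))"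
    if \<rho>: "0 < \<rho>" "\<rho> < 1" and n: "odd n" "n \<ge> n\<^sub>0" and m: "1 \<le> m"
      and mn: "real m \<le> c * real n powr (1/2 - \<eta>)" and p: "p \<in> multilinear_polys n m"
    for \<rho> :: real and n m :: nat and p
  proof -
    have n0: "(100 * c) powr (1 / \<eta>) \<le> real n" "n > 0"
      using n(2) unfolding n\<^sub>0_def by linarith+
    have "100 * c = ((100 * c) powr (1 / \<eta>)) powr \<eta>"
      using assms by (simp add: powr_powr)
    also have "\<dots> \<le> real n powr \<eta>"
      using n0 assms by (intro powr_mono2) auto
    finally have c: "100 * c \<le> real n powr \<eta>" .
    have "100 * real m \<le> 100 * c * real n powr (1/2 - \<eta>)"
      using mn by simp
    also have "\<dots> \<le> real n powr \<eta> * real n powr (1/2 - \<eta>)"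
      by (intro mult_right_mono c) auto
    also have "\<dots> = sqrt (real n)"
      using n0 by (simp add: powr_add [symmetric] powr_half_sqrt)
    finally have "(100 * real m)\<^sup>2 \<le> (sqrt (real n))\<^sup>2"
      by (intro power_mono) auto
    then have mn2: "10000 * (real m)\<^sup>2 \<le> real n"
      by (simp add: power_mult_distrib)
    obtain N where N: "n = 2 * N + 1" using n(1) by (elim oddE)
    \<comment> \<open>Thus 2 M + 1 is the least odd number exceeding m.\<close>
    define M where "M = (m + 1) div 2"
    have M: "M \<ge> 1" "m \<le> 2 * M" "M \<le> m" "2 * M \<le> m + 1"
      using m unfolding M_def by auto
    have "(real M)\<^sup>2 \<le> (real m)\<^sup>2" using M by (intro power_mono) auto
    then have Mn: "10000 * (real M)\<^sup>2 \<le> real n" using mn2 by linarith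
    obtain L r where Lr: "L \<ge> 1" "N = M + L + r"
        "real r \<ge> real (M + 1 + L) * (1 + 1 / sqrt (real M) + 1 / sqrt (real L))"
        "real M + real L + 1 \<ge> real n / 16"
        "real r \<le> (real M + real L + 1) * (1 + 2 / sqrt (real M)) + 5"
      using exists_parameters[OF M(1) N Mn] by blast
    define s where "s = (real M + 1/2) / (real M + real L + 1)"
    let ?T = "real M + real L + 1"
    have n_eq: "n = 2 * (M + L + r) + 1" using N Lr(2) by simp
    have T: "?T > 0" "?T \<ge> 625 * (real M)\<^sup>2" using Lr(4) Mn by linarith+
    have M1: "real M \<ge> 1" using M by simp
    have sT: "s * ?T = real M + 1/2" using T by (simp add: s_def)
    have s0: "s > 0" using T by (simp add: s_def)
    \<comment> \<open>The product s M is of order M^2 / \<open>?T\<close>, so n being large against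
      M^2 makes it small; this controls the second-order error r s^2.\<close>
    have "s * (625 * (real M)\<^sup>2) \<le> s * ?T" using s0 T by (intro mult_left_mono) auto
    also have "\<dots> \<le> 3/2 * real M" using sT M1 by simp
    finally have "real M * (s * real M * 625) \<le> real M * (3/2)"
      by (simp add: power2_eq_square mult_ac)
    then have sM: "s * real M \<le> 3 / 1250" using M1 by (subst (asm) mult_le_cancel_left_pos) auto
    have "s * 1 \<le> s * real M" using s0 M1 by (intro mult_left_mono) auto
    then have s_small: "s \<le> 3 / 1250" using sM by simp
    have sqM: "sqrt (real M) \<ge> 1" "sqrt (real M) * sqrt (real M) = real M" "sqrt (real M) \<le> real M"
      using M1 by (auto simp: real_le_lsqrt power2_eq_square intro: order.trans)
    have "real r * s \<le> (?T * (1 + 2 / sqrt (real M)) + 5) * s"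
      using s0 Lr(5) by (intro mult_right_mono) auto
    also have "\<dots> = (s * ?T) * (1 + 2 / sqrt (real M)) + 5 * s"
      proof -
      have "(x * y + 5) * s = s * x * y + 5 * s" for x y :: real
        by (simp add: algebra_simps)
      then show ?thesis .
    qed
    also have "\<dots> = real M + 1/2 + 2 * (real M / sqrt (real M)) + 1 / sqrt (real M) + 5 * s"
      unfolding sT by (simp add: algebra_simps add_divide_distrib)
    also have "real M / sqrt (real M) = sqrt (real M)"
      by (simp add: real_div_sqrt)
    also have "real M + 1/2 + 2 * sqrt (real M) + 1 / sqrt (real M) + 5 * s \<le> real M + 2 * sqrt (real M) + 2"
    proof -
      have "1 / sqrt (real M) \<le> 1" using sqM by simp
      then show ?thesis using s_small by simp
    qed
    finally have rs: "real r * s \<le> real M + 2 * sqrt (real M) + 2" .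
    also have "\<dots> \<le> 5 * real M" using sqM M1 by linarith
    finally have "real r * s * s \<le> 5 * real M * s"
      using s0 by (intro mult_right_mono) auto
    then have rss: "real r * s * s \<le> 1/2" using sM by (simp add: mult_ac)
    have "exp (-7) * (\<rho>\<^sup>2) ^ (M - 1) \<le> (1 - (1 - \<rho>\<^sup>2) * s) ^ r"
      using s0 s_small by (intro damping_ge[OF \<rho> M(1) _ _ rs rss]) auto
    \<comment> \<open>By 2 M \<le> m + 1 the exponent 2 m - 2 M is at least 2 (M - 1), so the
      damping costs no more than the missing power of \<rho>.\<close>
    moreover have "\<rho> ^ (2 * m - 2 * M) \<le> \<rho> ^ (2 * (M - 1))"
      using \<rho> M by (intro power_decreasing) auto
    then have "exp (-7) * \<rho> ^ (2 * m - 2 * M) \<le> exp (-7) * (\<rho>\<^sup>2) ^ (M - 1)"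
      by (simp add: power_mult)
    ultimately have "exp (-7) * \<rho> ^ (2 * m - 2 * M) \<le> (1 - (1 - \<rho>\<^sup>2) * s) ^ r"
      by linarith
    then have "\<rho> ^ (2 * M + 1) * (exp (-7) * \<rho> ^ (2 * m - 2 * M)) \<le> \<rho> ^ (2 * M + 1) * (1 - (1 - \<rho>\<^sup>2) * s) ^ r"
      using \<rho> by (intro mult_left_mono) auto
    moreover have "2 * m + 1 = (2 * M + 1) + (2 * m - 2 * M)" using M by simp
    ultimately have numerator: "exp (-7) * \<rho> ^ (2 * m + 1) \<le> \<rho> ^ (2 * M + 1) * (1 - (1 - \<rho>\<^sup>2) * s) ^ r"
      by (simp only: power_add mult_ac)
    have "real n * s \<le> (16 * ?T) * s"
      using Lr(4) s0 by (intro mult_right_mono) auto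
    also have "\<dots> = 16 * (real M + 1/2)" unfolding sT [symmetric] by (simp only: mult_ac)
    also have "\<dots> \<le> 5\<^sup>2 * real m" using M M1 by simp
    finally have "sqrt (real n * s) \<le> sqrt (5\<^sup>2 * real m)" by (rule real_sqrt_le_mono)
    then have denominator: "32 * sqrt (real n * s) \<le> 160 * sqrt (real m)"
      by (simp add: real_sqrt_mult mult_ac)
    have "exp (-7) / 160 * (\<rho> ^ (2 * m + 1) / sqrt (real m)) = exp (-7) * \<rho> ^ (2 * m + 1) / (160 * sqrt (real m))"
      by simp
    also have "\<dots> \<le> \<rho> ^ (2 * M + 1) * (1 - (1 - \<rho>\<^sup>2) * s) ^ r / (32 * sqrt (real n * s))"
    proof (rule frac_le [OF _ numerator _ denominator])
      show "0 \<le> \<rho> ^ (2 * M + 1) * (1 - (1 - \<rho>\<^sup>2) * s) ^ r"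
        by (rule order.trans [OF _ numerator]) (use \<rho> in simp)
      show "0 < 32 * sqrt (real n * s)"
        using s0 n0 by simp
    qed
    also have "\<dots> \<le> L1_norm n (\<lambda>x. noise_op n \<rho> (Maj n) x - p x)"
      unfolding s_def by (rule L1_norm_noise_Maj_ge[OF \<rho> M(1) Lr(1) n_eq Lr(3) p M(2)])
    finally show ?thesis .
  qed
  show ?thesis
  proof (intro exI[of _ n\<^sub>0] exI[of _ "exp (-7) / 160"] conjI allI impI)
    fix \<rho> :: real and n m :: nat
    assume hyps: "0 < \<rho>" "\<rho> < 1" "odd n" "n \<ge> n\<^sub>0" "1 \<le> m" "real m \<le> c * real n powr (1/2 - \<eta>)"
    show "exp (-7) / 160 * (\<rho> ^ (2 * m + 1) / sqrt (real m))
       \<le> (INF p \<in> multilinear_polys n m. L1_norm n (\<lambda>x. noise_op n \<rho> (Maj n) x - p x))"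
    proof (rule cINF_greatest)
      show "multilinear_polys n m \<noteq> {}" by (auto simp: multilinear_polys_def)
      show "exp (-7) / 160 * (\<rho> ^ (2 * m + 1) / sqrt (real m)) \<le> L1_norm n (\<lambda>x. noise_op n \<rho> (Maj n) x - p x)"
        if "p \<in> multilinear_polys n m" for p
        using main[OF hyps that] .
    qed
  qed simp
qed

end
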